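(* Let $1\le p<\infty$ and $f\in M^p(\mathbb{R})$. If $\alpha>0$, then the Bochner–Riesz means $$B_N^\alpha f:=\sum_{n=0}^N\Big(1-\frac{|n|^2}{N^2}\Big)^\alpha\langle f,h_n\rangle h_n,\qquad N\in\mathbb{N},$$ converge to $f$ in $M^p(\mathbb{R})$ as $N\to\infty$.
   Context: $\mathbb{N}=\{1,2,\dots\}$, $\mathbb{N}_0=\mathbb{N}\cup\{0\}$. Hermite functions: for $n\in\mathbb{N}_0$, $h_n(t)=C_n e^{\pi t^2}\frac{d^n}{dt^n}\big(e^{-2\pi t^2}\big)$, $t\in\mathbb{R}$, where the real constant $C_n$ has sign $(-1)^n$ and is chosen so that $\|h_n\|_{L^2(\mathbb{R})}=1$. The family $(h_n)_{n\in\mathbb{N}_0}$ is an orthonormal basis of $L^2(\mathbb{R})$. Time-frequency shifts: for $z=(x,\omega)\in\mathbb{R}^2$, $\pi(z)f(t)=e^{2\pi i\omega t}f(t-x)$. Pairing: $\langle f,g\rangle=\int f\overline{g}$ on $L^2(\mathbb{R})$, extended to $f\in\mathcal{S}'(\mathbb{R})$ (tempered distributions), $g\in\mathcal{S}(\mathbb{R})$ (linear in $f$, antilinear in $g$). Modulation spaces: with $\varphi(t)=2^{1/4}e^{-\pi t^2}$ and $1\le p<\infty$, $$M^p(\mathbb{R})=\Big\{f\in\mathcal{S}'(\mathbb{R}):\ \|f\|_{M^p(\mathbb{R})}^p:=\int_{\mathbb{R}^{2}}|\langle f,\pi(z)\varphi\rangle|^p\,dz<\infty\Big\}.$$ *)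

theory Defs
  imports "HOL-Analysis.Analysis"
begin

definition iter_vderiv :: "nat \<Rightarrow> (real \<Rightarrow> complex) \<Rightarrow> real \<Rightarrow> complex" where
  "iter_vderiv k g = ((\<lambda>u x. vector_derivative u (at x)) ^^ k) g"

definition schwartz_space :: "(real \<Rightarrow> complex) set" where
  "schwartz_space =
     {g. (\<forall>k x. iter_vderiv k g differentiable (at x)) \<and>
         (\<forall>j k. bdd_above (range (\<lambda>x. \<bar>x\<bar> ^ j * norm (iter_vderiv k g x))))}"

definition schwartz_seminorm :: "nat \<Rightarrow> nat \<Rightarrow> (real \<Rightarrow> complex) \<Rightarrow> real" where
  "schwartz_seminorm j k g = (SUP x. \<bar>x\<bar> ^ j * norm (iter_vderiv k g x))"

(* A distribution is a functional on all functions of which only the values on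
   schwartz_space matter. The last clause is continuity with respect to the
   locally convex topology generated by the seminorms. *)
definition tempered_distribution :: "((real \<Rightarrow> complex) \<Rightarrow> complex) \<Rightarrow> bool" where
  "tempered_distribution T \<longleftrightarrow>
     (\<forall>g\<in>schwartz_space. \<forall>h\<in>schwartz_space. T (\<lambda>x. g x + h x) = T g + T h) \<and>
     (\<forall>c. \<forall>g\<in>schwartz_space. T (\<lambda>x. c * g x) = c * T g) \<and>
     (\<forall>g\<in>schwartz_space. \<forall>\<epsilon>>0. \<exists>m. \<exists>\<delta>>0. \<forall>h\<in>schwartz_space.
        (\<forall>j\<le>m. \<forall>k\<le>m. schwartz_seminorm j k (\<lambda>x. h x - g x) < \<delta>) \<longrightarrow> norm (T h - T g) < \<epsilon>)"

definition distribution_of :: "(real \<Rightarrow> complex) \<Rightarrow> (real \<Rightarrow> complex) \<Rightarrow> complex" where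
  "distribution_of u g = (LINT t|lborel. u t * g t)"

(* Distributions act linearly on test functions; the pairing extends the
   L2 inner product and is therefore antilinear in its second argument. *)
definition pairing :: "((real \<Rightarrow> complex) \<Rightarrow> complex) \<Rightarrow> (real \<Rightarrow> complex) \<Rightarrow> complex" where
  "pairing T g = T (\<lambda>t. cnj (g t))"

definition tf_shift :: "real \<times> real \<Rightarrow> (real \<Rightarrow> complex) \<Rightarrow> real \<Rightarrow> complex" where
  "tf_shift z g t = exp (2 * of_real pi * \<i> * of_real (snd z) * of_real t) * g (t - fst z)"

definition gaussian_window :: "real \<Rightarrow> complex" where
  "gaussian_window t = of_real (2 powr (1/4) * exp (- pi * t\<^sup>2))"

definition modulation_integral :: "real \<Rightarrow> ((real \<Rightarrow> complex) \<Rightarrow> complex) \<Rightarrow> ennreal" where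
  "modulation_integral p T =
     (\<integral>\<^sup>+z. ennreal (norm (pairing T (tf_shift z gaussian_window)) powr p) \<partial>lborel)"

definition modulation_norm :: "real \<Rightarrow> ((real \<Rightarrow> complex) \<Rightarrow> complex) \<Rightarrow> ennreal" where
  "modulation_norm p T =
     (if modulation_integral p T = \<infinity> then \<infinity>
      else ennreal (enn2real (modulation_integral p T) powr (1/p)))"

definition modulation_space :: "real \<Rightarrow> ((real \<Rightarrow> complex) \<Rightarrow> complex) set" where
  "modulation_space p = {T. tempered_distribution T \<and> modulation_integral p T < \<infinity>}"

definition L2_norm :: "(real \<Rightarrow> real) \<Rightarrow> real" where
  "L2_norm g = sqrt (LINT t|lborel. \<bar>g t\<bar>\<^sup>2)"

definition hermite_raw :: "nat \<Rightarrow> real \<Rightarrow> real" where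
  "hermite_raw n t = exp (pi * t\<^sup>2) * (deriv ^^ n) (\<lambda>s. exp (- 2 * pi * s\<^sup>2)) t"

definition hermite_const :: "nat \<Rightarrow> real" where
  "hermite_const n =
     (THE c. sgn c = (- 1) ^ n \<and> L2_norm (\<lambda>t. c * hermite_raw n t) = 1)"

definition hermite_fun :: "nat \<Rightarrow> real \<Rightarrow> complex" where
  "hermite_fun n t = of_real (hermite_const n * hermite_raw n t)"

definition bochner_riesz ::
    "real \<Rightarrow> nat \<Rightarrow> ((real \<Rightarrow> complex) \<Rightarrow> complex) \<Rightarrow> real \<Rightarrow> complex" where
  "bochner_riesz \<alpha> N T t =
     (\<Sum>n=0..N. of_real ((1 - (real n)\<^sup>2 / (real N)\<^sup>2) powr \<alpha>) * pairing T (hermite_fun n) * hermite_fun n t)"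

end

theory Submission
  imports Defs "HOL-Complex_Analysis.Cauchy_Integral_Formula"
begin

text \<open>
  The short-time Fourier transform with Gaussian window turns a tempered distribution into an entire function
  times a Gaussian weight on the phase plane, and it turns the Hermite expansion into the Taylor expansion
  (\<open>pairing_tf_shift\<close>). In this picture the Bochner-Riesz means multiply the \<open>n\<close>-th Taylor coefficient
  by \<open>(1 - n\<^sup>2 / N\<^sup>2) powr \<alpha>\<close> (\<open>bochner_riesz_moments\<close>), and the modulation norm is a weighted \<open>L\<^sup>p\<close> norm
  over the plane that is invariant under rotations. A Taylor multiplier is a convolution over rotations with a kernel on
  the circle that has the multiplier as its Fourier coefficients (\<open>fock_riesz_average\<close>). Hence, although the
  Hermite functions live on the line, the statement reduces to one about Fourier series in one variable, and there every exponent
  \<open>\<alpha> > 0\<close> is above the critical index of the Bochner-Riesz means.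

  For \<open>\<alpha> \<le> 1\<close> the weights are concave in \<open>n\<close>. Summation by parts then bounds the kernel by a constant times
  \<open>N (1 + N |\<theta>|) powr (- 1 - \<alpha>)\<close> (\<open>riesz_kernel_bound\<close>): it is an approximate identity. Minkowski's integral inequality
  gives uniform boundedness of the means (\<open>energy_riesz_le\<close>), and continuity of rotations in \<open>L\<^sup>p\<close> gives their
  convergence (\<open>energy_riesz_tendsto\<close>). For larger \<open>\<alpha>\<close> the means are iterated means with a small exponent, and both
  properties pass to products (\<open>approximating_mult\<close>).

  Distributions require one analytic input: the Taylor series of the generating function of the Hermite functions
  converges in the Schwartz topology (\<open>remainder_span_schwartz\<close>), so that distributions can be applied to it term by term.
\<close>

section \<open>Hermite functions and their generating function\<close>

text \<open>The Rodrigues formula is real, but growth of high derivatives is controlled most easily by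
  Cauchy's inequality, so the Gaussian is differentiated as an entire function.\<close>

definition cgauss :: "complex \<Rightarrow> complex" where
  "cgauss w = exp (- 2 * of_real pi * w\<^sup>2)"

lemma cgauss_holomorphic: "cgauss holomorphic_on A"
  unfolding cgauss_def by (intro holomorphic_intros)

lemma cgauss_higher_deriv:
  "((deriv ^^ n) cgauss has_field_derivative (deriv ^^ Suc n) cgauss w) (at w)"
proof -
  have "(deriv ^^ n) cgauss holomorphic_on UNIV"
    by (intro holomorphic_higher_deriv cgauss_holomorphic) auto
  then show ?thesis
    using holomorphic_derivI[of "(deriv ^^ n) cgauss" UNIV w] by simp
qed

text \<open>Differentiate \<open>g' = - 4 \<pi> w g\<close> another \<open>n\<close> times by Leibniz; since \<open>w\<close> is linear only two terms survive.\<close>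

lemma cgauss_higher_deriv_rec:
  "(deriv ^^ Suc n) cgauss w
    = - 4 * of_real pi * (w * (deriv ^^ n) cgauss w + of_nat n * (deriv ^^ (n - 1)) cgauss w)"
proof (induction n arbitrary: w)
  case 0
  have "(cgauss has_field_derivative - 4 * of_real pi * w * cgauss w) (at w)"
    unfolding cgauss_def by (auto intro!: derivative_eq_intros)
  from DERIV_imp_deriv[OF this] show ?case by (simp add: mult.assoc)
next
  case (Suc n)
  have eq: "(deriv ^^ Suc n) cgauss
    = (\<lambda>w. - 4 * of_real pi * (w * (deriv ^^ n) cgauss w + of_nat n * (deriv ^^ (n - 1)) cgauss w))"
    by (rule ext) (rule Suc.IH)
  have d0: "((deriv ^^ n) cgauss has_field_derivative (deriv ^^ Suc n) cgauss w) (at w)"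
    by (rule cgauss_higher_deriv)
  have d1: "((\<lambda>w. of_nat n * (deriv ^^ (n - 1)) cgauss w) has_field_derivative
      of_nat n * (deriv ^^ n) cgauss w) (at w)"
  proof (cases n)
    case (Suc m)
    then show ?thesis using DERIV_cmult[OF cgauss_higher_deriv[of m w], of "of_nat n"] by simp
  qed simp
  have "((\<lambda>w. w * (deriv ^^ n) cgauss w) has_field_derivative
      (deriv ^^ n) cgauss w + (deriv ^^ Suc n) cgauss w * w) (at w)"
    by (rule DERIV_cong[OF DERIV_mult[OF DERIV_ident d0]]) (simp del: funpow.simps)
  from DERIV_cmult[OF DERIV_add[OF this d1], of "- 4 * of_real pi"]
  have "((deriv ^^ Suc n) cgauss has_field_derivative
      - 4 * of_real pi * ((deriv ^^ n) cgauss w + (deriv ^^ Suc n) cgauss w * w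
        + of_nat n * (deriv ^^ n) cgauss w)) (at w)"
    by (simp only: eq)
  from DERIV_imp_deriv[OF this] have "(deriv ^^ Suc (Suc n)) cgauss w = - 4 * of_real pi * ((deriv ^^ n) cgauss w + (deriv ^^ Suc n) cgauss w * w
        + of_nat n * (deriv ^^ n) cgauss w)" by simp
  then show ?case by (simp add: algebra_simps del: funpow.simps)
qed

text \<open>The recursion shows that the complex derivatives are real on the real line, so they
  agree with the derivatives taken along it.\<close>

lemma real_gauss_higher_deriv:
  "of_real ((deriv ^^ n) (\<lambda>s. exp (- 2 * pi * s\<^sup>2)) t) = (deriv ^^ n) cgauss (of_real t)"
proof -
  have im: "Im ((deriv ^^ n) cgauss (of_real t)) = 0" for n t
  proof (induction n rule: less_induct)
    case (less n)
    show ?case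
    proof (cases n)
      case 0
      have "cgauss (of_real t) = of_real (exp (- 2 * pi * t\<^sup>2))"
        unfolding cgauss_def exp_of_real[symmetric] by simp
      then show ?thesis using 0 by simp
    next
      case (Suc m)
      have "Im ((deriv ^^ m) cgauss (of_real t)) = 0" "Im ((deriv ^^ (m-1)) cgauss (of_real t)) = 0"
        using less Suc by auto
      then show ?thesis unfolding Suc cgauss_higher_deriv_rec by simp
    qed
  qed
  define g where "g = (\<lambda>s::real. exp (- 2 * pi * s\<^sup>2))"
  have re: "(deriv ^^ n) g = (\<lambda>t. Re ((deriv ^^ n) cgauss (of_real t)))"
  proof (induction n)
    case 0
    have "Re (cgauss (of_real t)) = exp (- 2 * pi * t\<^sup>2)" for t :: real
    proof -
      have "cgauss (of_real t) = of_real (exp (- 2 * pi * t\<^sup>2))"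
        unfolding cgauss_def exp_of_real[symmetric] by simp
      then show ?thesis by simp
    qed
    then show ?case by (auto simp: g_def)
  next
    case (Suc n)
    have d: "((\<lambda>t. Re ((deriv ^^ n) cgauss (of_real t))) has_field_derivative
        Re ((deriv ^^ Suc n) cgauss (of_real t))) (at t)" for t
      by (rule has_field_derivative_Re, rule has_vector_derivative_real_field,
          rule cgauss_higher_deriv)
    show ?case using DERIV_imp_deriv[OF d] by (simp add: Suc.IH fun_eq_iff)
  qed
  show ?thesis unfolding re[unfolded g_def] using im[of n t] by (simp add: complex_eq_iff)
qed

lemma hermite_raw_eq:
  "of_real (hermite_raw n t) = of_real (exp (pi * t\<^sup>2)) * (deriv ^^ n) cgauss (of_real t)"
  unfolding hermite_raw_def real_gauss_higher_deriv[symmetric] by simp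

lemma hermite_raw_rec:
  "hermite_raw (Suc n) t = - 4 * pi * (t * hermite_raw n t + real n * hermite_raw (n - 1) t)"
proof -
  have "complex_of_real (hermite_raw (Suc n) t)
      = of_real (- 4 * pi * (t * hermite_raw n t + real n * hermite_raw (n - 1) t))"
    unfolding hermite_raw_eq cgauss_higher_deriv_rec by (simp add: hermite_raw_eq algebra_simps)
  then show ?thesis using of_real_eq_iff by blast
qed

lemma hermite_raw_0: "hermite_raw 0 t = exp (- pi * t\<^sup>2)"
  by (simp add: hermite_raw_def exp_add[symmetric])

text \<open>The annihilation operator: differentiation together with multiplication by \<open>2 \<pi> t\<close> lowers the degree.
  With \<open>hermite_raw_rec\<close> this is the whole ladder structure that is used below.\<close>

lemma hermite_raw_deriv:
  "(hermite_raw n has_real_derivative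
     - 2 * pi * t * hermite_raw n t - 4 * pi * real n * hermite_raw (n - 1) t) (at t)"
proof -
  have g: "((\<lambda>t. Re ((deriv ^^ n) cgauss (of_real t))) has_field_derivative
        Re ((deriv ^^ Suc n) cgauss (of_real t))) (at t)" for t
      by (rule has_field_derivative_Re, rule has_vector_derivative_real_field,
          rule cgauss_higher_deriv)
  have h: "hermite_raw n t = exp (pi * t\<^sup>2) * Re ((deriv ^^ n) cgauss (of_real t))" for n t
    using arg_cong[OF hermite_raw_eq[of n t], of Re] by simp
  have "((\<lambda>t. exp (pi * t\<^sup>2) * Re ((deriv ^^ n) cgauss (of_real t))) has_real_derivative
     2 * pi * t * hermite_raw n t + hermite_raw (Suc n) t) (at t)"
    by (rule DERIV_cong[OF DERIV_mult[OF _ g]], rule DERIV_fun_exp, rule DERIV_cmult, rule DERIV_pow)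
       (simp add: h algebra_simps del: funpow.simps)
  also have "(\<lambda>t. exp (pi * t\<^sup>2) * Re ((deriv ^^ n) cgauss (of_real t))) = hermite_raw n"
    using h by auto
  finally show ?thesis unfolding hermite_raw_rec by (simp add: algebra_simps)
qed

text \<open>Cauchy's inequality on the circle of radius \<open>r\<close> about \<open>t\<close>. The radius stays free:
  for a Taylor series at the parameter \<open>s\<close> a radius beyond \<open>2 |s|\<close> turns the factor \<open>r ^ n\<close> into geometric decay.\<close>

lemma hermite_raw_bound:
  assumes "r > 0"
  shows "\<bar>hermite_raw n t\<bar> \<le> fact n / r ^ n * exp (- pi * t\<^sup>2 + 4 * pi * r * \<bar>t\<bar> + 2 * pi * r\<^sup>2)"
proof -
  define B where "B = exp (- 2 * pi * t\<^sup>2 + 4 * pi * r * \<bar>t\<bar> + 2 * pi * r\<^sup>2)"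
  have "norm (cgauss x) \<le> B" if x: "norm (of_real t - x) = r" for x
  proof -
    define a where "a = x - of_real t"
    have a: "norm a = r" using x by (simp add: a_def norm_minus_commute)
    have "Re (x\<^sup>2) = (t + Re a)\<^sup>2 - (Im a)\<^sup>2"
      unfolding a_def by (simp add: power2_eq_square)
    also have "\<dots> \<ge> t\<^sup>2 - 2 * \<bar>t\<bar> * r - r\<^sup>2"
    proof -
      have "(Re a)\<^sup>2 + (Im a)\<^sup>2 = r\<^sup>2" using a cmod_power2 by metis
      moreover have "\<bar>t * Re a\<bar> \<le> \<bar>t\<bar> * r"
        unfolding abs_mult using abs_Re_le_cmod[of a] a by (intro mult_left_mono) auto
      moreover have "0 \<le> (Re a)\<^sup>2" by simp
      moreover have "(t + Re a)\<^sup>2 = t\<^sup>2 + 2 * (t * Re a) + (Re a)\<^sup>2" by (simp add: power2_sum)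
      ultimately show ?thesis by linarith
    qed
    finally have "2 * pi * (t\<^sup>2 - 2 * \<bar>t\<bar> * r - r\<^sup>2) \<le> 2 * pi * Re (x\<^sup>2)"
      by (intro mult_left_mono) auto
    then show ?thesis unfolding cgauss_def B_def norm_exp_eq_Re by (simp add: algebra_simps)
  qed
  then have "norm ((deriv ^^ n) cgauss (of_real t)) \<le> fact n * B / r ^ n"
    by (intro Cauchy_inequality holomorphic_on_imp_continuous_on cgauss_holomorphic assms) auto
  then have "exp (pi * t\<^sup>2) * norm ((deriv ^^ n) cgauss (of_real t)) \<le> exp (pi * t\<^sup>2) * (fact n * B / r ^ n)"
    by (intro mult_left_mono) auto
  moreover have "\<bar>hermite_raw n t\<bar> = exp (pi * t\<^sup>2) * norm ((deriv ^^ n) cgauss (of_real t))"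
    using arg_cong[OF hermite_raw_eq[of n t], of norm] by (simp add: norm_mult)
  moreover have "exp (pi * t\<^sup>2) * B = exp (- pi * t\<^sup>2 + 4 * pi * r * \<bar>t\<bar> + 2 * pi * r\<^sup>2)"
    unfolding B_def exp_add[symmetric] by simp
  moreover have "exp (pi * t\<^sup>2) * (fact n * B / r ^ n) = fact n / r ^ n * (exp (pi * t\<^sup>2) * B)"
    by simp
  ultimately show ?thesis by (simp only:)
qed

text \<open>The generating function of the Hermite functions. Every time-frequency shift of the Gaussian is,
  up to a scalar factor, one of these functions, with a complex parameter encoding the phase space point.\<close>

definition hermite_gen :: "complex \<Rightarrow> real \<Rightarrow> complex" where
  "hermite_gen s t = exp (- of_real (pi * t\<^sup>2) - 4 * of_real (pi * t) * s - 2 * of_real pi * s\<^sup>2)"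

definition hermite_term :: "complex \<Rightarrow> nat \<Rightarrow> real \<Rightarrow> complex" where
  "hermite_term s n t = s ^ n / fact n * of_real (hermite_raw n t)"

text \<open>Up to the factor \<open>exp (\<pi> t\<^sup>2)\<close>, this is the Taylor series of the complex Gaussian about \<open>t\<close>, evaluated at \<open>t + s\<close>.\<close>

lemma hermite_gen_sums: "(\<lambda>n. hermite_term s n t) sums hermite_gen s t"
proof -
  have "(\<lambda>n. (deriv ^^ n) cgauss (of_real t) / fact n * ((of_real t + s) - of_real t) ^ n) sums cgauss (of_real t + s)"
    by (rule holomorphic_power_series[where r = "norm s + 1"]) (auto intro: cgauss_holomorphic simp: dist_norm)
  from sums_mult[OF this, of "of_real (exp (pi * t\<^sup>2))"]
  have "(\<lambda>n. hermite_term s n t) sums (of_real (exp (pi * t\<^sup>2)) * cgauss (of_real t + s))"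
    by (simp add: hermite_term_def hermite_raw_eq algebra_simps)
  also have "of_real (exp (pi * t\<^sup>2)) * cgauss (of_real t + s) = hermite_gen s t"
    unfolding cgauss_def hermite_gen_def exp_of_real[symmetric] exp_add[symmetric]
    by (rule arg_cong[where f = exp]) (simp add: power2_eq_square algebra_simps)
  finally show ?thesis .
qed

section \<open>The generating series in Schwartz space\<close>

lemma hermite_term_deriv:
  "(hermite_term s n has_vector_derivative
     - 2 * of_real (pi * t) * hermite_term s n t
     - 4 * of_real pi * s * (if n = 0 then 0 else hermite_term s (n - 1) t)) (at t)"
proof -
  have "((\<lambda>t. s ^ n / fact n * complex_of_real (hermite_raw n t)) has_vector_derivative
     s ^ n / fact n * of_real (- 2 * pi * t * hermite_raw n t - 4 * pi * real n * hermite_raw (n - 1) t)) (at t)"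
    by (intro has_vector_derivative_mult_right has_vector_derivative_of_real)
       (use hermite_raw_deriv has_real_derivative_iff_has_vector_derivative in blast)
  moreover have "s ^ n / fact n * of_real (- 2 * pi * t * hermite_raw n t - 4 * pi * real n * hermite_raw (n - 1) t)
    = - 2 * of_real (pi * t) * hermite_term s n t
     - 4 * of_real pi * s * (if n = 0 then 0 else hermite_term s (n - 1) t)"
  proof (cases n)
    case (Suc m)
    have coeff: "s ^ Suc m / fact (Suc m) * of_nat (Suc m) = s * (s ^ m / fact m)"
      by (simp add: field_simps del: of_nat_Suc)
    have alg: "A * (- 2 * p * u * H - 4 * p * N * H') = - 2 * (p * u) * (A * H) - 4 * p * s * (B * H')"
      if "A * N = s * B" for A N B p u H H' :: complex
      using that by algebra
    show ?thesis unfolding Suc hermite_term_def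
      using alg[OF coeff, of "of_real pi" "of_real t" "of_real (hermite_raw (Suc m) t)" "of_real (hermite_raw m t)"]
      by (simp only: diff_Suc_1 of_real_diff of_real_mult of_real_neg_numeral of_real_numeral
          of_real_of_nat_eq Suc_not_Zero if_False)
  qed (simp add: hermite_term_def)
  ultimately show ?thesis unfolding hermite_term_def[abs_def] by (simp only:)
qed

definition hermite_rem :: "complex \<Rightarrow> nat \<Rightarrow> real \<Rightarrow> complex" where
  "hermite_rem s M t = hermite_gen s t - (\<Sum>n<M. hermite_term s n t)"

text \<open>The derivative of a Taylor remainder is a combination of \<open>t\<close> times the same remainder and of the
  previous remainder, with coefficients that do not depend on \<open>M\<close>. For \<open>M = 0\<close> the truncated
  subtraction is right, because the remainder is then the generating function itself.\<close>

lemma hermite_rem_deriv: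
  "(hermite_rem s M has_vector_derivative
     - 2 * of_real pi * (of_real t * hermite_rem s M t) - 4 * of_real pi * s * hermite_rem s (M - 1) t) (at t)"
proof -
  have gen: "(hermite_gen s has_vector_derivative
       (- 2 * of_real (pi * t) - 4 * of_real pi * s) * hermite_gen s t) (at t)"
  proof -
    have "((\<lambda>w. exp (- (of_real pi * w\<^sup>2) - 4 * (of_real pi * w) * s - 2 * of_real pi * s\<^sup>2)) has_field_derivative
       (- 2 * of_real (pi * t) - 4 * of_real pi * s) * hermite_gen s t) (at (of_real t))"
      unfolding hermite_gen_def by (auto intro!: derivative_eq_intros simp: algebra_simps)
    from has_vector_derivative_real_field[OF this]
    show ?thesis unfolding hermite_gen_def[abs_def] by simp
  qed
  have shift: "(\<Sum>n<M. if n = 0 then 0 else hermite_term s (n - 1) t) = (\<Sum>n<M - 1. hermite_term s n t)"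
    by (cases M) (simp_all add: sum.lessThan_Suc_shift del: sum.lessThan_Suc)
  have "(hermite_rem s M has_vector_derivative
     (- 2 * of_real (pi * t) - 4 * of_real pi * s) * hermite_gen s t
      - (\<Sum>n<M. - 2 * of_real (pi * t) * hermite_term s n t
     - 4 * of_real pi * s * (if n = 0 then 0 else hermite_term s (n - 1) t))) (at t)"
    unfolding hermite_rem_def[abs_def]
    by (intro has_vector_derivative_diff gen has_vector_derivative_sum hermite_term_deriv)
  also have "(- 2 * of_real (pi * t) - 4 * of_real pi * s) * hermite_gen s t
      - (\<Sum>n<M. - 2 * of_real (pi * t) * hermite_term s n t
     - 4 * of_real pi * s * (if n = 0 then 0 else hermite_term s (n - 1) t))
    = - 2 * of_real pi * (of_real t * hermite_rem s M t) - 4 * of_real pi * s * hermite_rem s (M - 1) t"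
    unfolding sum_subtractf sum_distrib_left[symmetric] shift hermite_rem_def by (simp add: algebra_simps)
  finally show ?thesis .
qed

text \<open>Absorb the power into \<open>exp |t|\<close> and complete the square.\<close>

lemma gaussian_majorant_bounded:
  fixes r :: real
  shows "\<exists>C. \<forall>t. \<bar>t\<bar> ^ j * exp (- pi * t\<^sup>2 + 4 * pi * r * \<bar>t\<bar> + 2 * pi * r\<^sup>2) \<le> C"
proof -
  have "\<bar>t\<bar> ^ j * exp (- pi * t\<^sup>2 + 4 * pi * r * \<bar>t\<bar> + 2 * pi * r\<^sup>2)
      \<le> fact j * exp (2 * pi * r\<^sup>2 + (4 * pi * r + 1)\<^sup>2 / (4 * pi))" for t
  proof -
    have "\<bar>t\<bar> ^ j /\<^sub>R fact j \<le> exp \<bar>t\<bar>"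
    proof -
      have "(\<Sum>n\<in>{j}. \<bar>t\<bar> ^ n /\<^sub>R fact n) \<le> (\<Sum>n. \<bar>t\<bar> ^ n /\<^sub>R fact n)"
        by (rule sum_le_suminf) (auto intro: summable_exp)
      then show ?thesis by (simp add: exp_def)
    qed
    then have "\<bar>t\<bar> ^ j \<le> fact j * exp \<bar>t\<bar>" by (simp add: field_simps)
    then have "\<bar>t\<bar> ^ j * exp (- pi * t\<^sup>2 + 4 * pi * r * \<bar>t\<bar> + 2 * pi * r\<^sup>2)
       \<le> fact j * exp \<bar>t\<bar> * exp (- pi * t\<^sup>2 + 4 * pi * r * \<bar>t\<bar> + 2 * pi * r\<^sup>2)"
      by (intro mult_right_mono) auto
    also have "\<dots> = fact j * exp (\<bar>t\<bar> + (- pi * t\<^sup>2 + 4 * pi * r * \<bar>t\<bar> + 2 * pi * r\<^sup>2))"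
      by (simp add: exp_add[symmetric] mult.assoc)
    also have "\<dots> \<le> fact j * exp (2 * pi * r\<^sup>2 + (4 * pi * r + 1)\<^sup>2 / (4 * pi))"
    proof -
      have "0 \<le> (2 * pi * \<bar>t\<bar> - (4 * pi * r + 1))\<^sup>2" by simp
      also have "\<dots> = 4 * pi * (pi * t\<^sup>2 - (4 * pi * r + 1) * \<bar>t\<bar> + (4 * pi * r + 1)\<^sup>2 / (4 * pi))"
        by (simp add: field_simps power2_eq_square)
      finally have "0 \<le> pi * t\<^sup>2 - (4 * pi * r + 1) * \<bar>t\<bar> + (4 * pi * r + 1)\<^sup>2 / (4 * pi)"
        by (simp add: zero_le_mult_iff) (use pi_gt_zero in linarith)
      then show ?thesis by (simp add: algebra_simps)
    qed
    finally show ?thesis .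
  qed
  then show ?thesis by blast
qed

lemma hermite_rem_bound:
  "\<exists>C. \<forall>M t. \<bar>t\<bar> ^ j * norm (hermite_rem s M t) \<le> C / 2 ^ M"
proof -
  \<comment> \<open>the extra summand keeps the radius positive at \<open>s = 0\<close>\<close>
  define r where "r = 2 * norm s + 1"
  have r: "r > 0" by (simp add: r_def add_nonneg_pos)
  define E where "E t = exp (- pi * t\<^sup>2 + 4 * pi * r * \<bar>t\<bar> + 2 * pi * r\<^sup>2)" for t
  obtain C where C: "\<And>t. \<bar>t\<bar> ^ j * E t \<le> C"
    using gaussian_majorant_bounded[of j r] unfolding E_def by blast
  have tm: "norm (hermite_term s n t) \<le> E t * (1/2) ^ n" for n t
  proof -
    have "norm (hermite_term s n t) = norm s ^ n / fact n * \<bar>hermite_raw n t\<bar>"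
      by (simp add: hermite_term_def norm_mult norm_divide norm_power)
    also have "\<dots> \<le> norm s ^ n / fact n * (fact n / r ^ n * E t)"
      unfolding E_def by (intro mult_left_mono hermite_raw_bound r) auto
    also have "\<dots> = (norm s / r) ^ n * E t" by (simp add: power_divide)
    also have "\<dots> \<le> (1/2) ^ n * E t"
      using r by (intro mult_right_mono power_mono) (auto simp: r_def E_def field_simps)
    finally show ?thesis by (simp add: mult.commute)
  qed
  have "\<bar>t\<bar> ^ j * norm (hermite_rem s M t) \<le> 2 * C / 2 ^ M" for M t
  proof -
    have "(\<lambda>n. hermite_term s (n + M) t) sums hermite_rem s M t"
      unfolding hermite_rem_def using hermite_gen_sums sums_split_initial_segment by blast
    moreover have "(\<lambda>n. E t * (1/2) ^ M * (1/2) ^ n) sums (E t * (1/2) ^ M * (1 / (1 - 1/2)))"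
      by (intro sums_mult geometric_sums) simp
    moreover have "norm (hermite_term s (n + M) t) \<le> E t * (1/2) ^ M * (1/2) ^ n" for n
      using tm[of "n + M" t] by (simp add: power_add mult.commute mult.left_commute)
    ultimately have "norm (hermite_rem s M t) \<le> E t * (1/2) ^ M * (1 / (1 - 1/2))"
      using norm_suminf_le sums_iff by metis
    then have "norm (hermite_rem s M t) \<le> 2 * E t / 2 ^ M"
      by (simp add: power_one_over mult.commute)
    then have "\<bar>t\<bar> ^ j * norm (hermite_rem s M t) \<le> \<bar>t\<bar> ^ j * (2 * E t / 2 ^ M)"
      by (intro mult_left_mono) auto
    also have "\<dots> = 2 * (\<bar>t\<bar> ^ j * E t) / 2 ^ M" by simp
    also have "\<dots> \<le> 2 * C / 2 ^ M" using C by (intro divide_right_mono mult_left_mono) auto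
    finally show ?thesis .
  qed
  then show ?thesis by blast
qed

text \<open>The smallest class of sequences of functions that contains the Taylor remainders and is closed
  under the operations in \<open>hermite_rem_deriv\<close>. It is closed under differentiation, and on it every
  polynomially weighted supremum decays like \<open>2 ^ (- M)\<close>; both follow by rule induction. So all
  Schwartz seminorms are treated without computing a single higher derivative.\<close>

inductive remainder_span :: "complex \<Rightarrow> (nat \<Rightarrow> real \<Rightarrow> complex) \<Rightarrow> bool" for s where
  base: "remainder_span s (hermite_rem s)"
| times: "remainder_span s Q \<Longrightarrow> remainder_span s (\<lambda>M t. of_real t * Q M t)"
| shift: "remainder_span s Q \<Longrightarrow> remainder_span s (\<lambda>M. Q (M - 1))"
| add: "remainder_span s Q \<Longrightarrow> remainder_span s Q' \<Longrightarrow> remainder_span s (\<lambda>M t. Q M t + Q' M t)"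
| scale: "remainder_span s Q \<Longrightarrow> remainder_span s (\<lambda>M t. c * Q M t)"

lemma remainder_span_bound:
  "remainder_span s Q \<Longrightarrow> \<exists>C. \<forall>M t. \<bar>t\<bar> ^ j * norm (Q M t) \<le> C / 2 ^ M"
proof (induction arbitrary: j rule: remainder_span.induct)
  case base
  show ?case by (rule hermite_rem_bound)
next
  case (times Q)
  obtain C where "\<forall>M t. \<bar>t\<bar> ^ Suc j * norm (Q M t) \<le> C / 2 ^ M" using times.IH by blast
  then show ?case by (auto simp: norm_mult algebra_simps intro!: exI[of _ C])
next
  case (shift Q)
  obtain C where C: "\<forall>M t. \<bar>t\<bar> ^ j * norm (Q M t) \<le> C / 2 ^ M" using shift.IH by blast
  have "0 \<le> \<bar>0 :: real\<bar> ^ j * norm (Q 0 0)" by (intro mult_nonneg_nonneg) auto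
  also have "\<dots> \<le> C / 2 ^ 0" using C by blast
  finally have "0 \<le> C" by simp
  have "\<bar>t\<bar> ^ j * norm (Q (M - 1) t) \<le> 2 * C / 2 ^ M" for M t
  proof -
    have "C / 2 ^ (M - 1) \<le> 2 * C / 2 ^ M" using \<open>0 \<le> C\<close> by (cases M) auto
    then show ?thesis using C order_trans by blast
  qed
  then show ?case by blast
next
  case (add Q Q')
  obtain C where C: "\<forall>M t. \<bar>t\<bar> ^ j * norm (Q M t) \<le> C / 2 ^ M" using add.IH(1) by blast
  obtain C' where C': "\<forall>M t. \<bar>t\<bar> ^ j * norm (Q' M t) \<le> C' / 2 ^ M" using add.IH(2) by blast
  have "\<bar>t\<bar> ^ j * norm (Q M t + Q' M t) \<le> (C + C') / 2 ^ M" for M t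
  proof -
    have "\<bar>t\<bar> ^ j * norm (Q M t + Q' M t) \<le> \<bar>t\<bar> ^ j * (norm (Q M t) + norm (Q' M t))"
      by (intro mult_left_mono norm_triangle_ineq) auto
    also have "\<dots> \<le> C / 2 ^ M + C' / 2 ^ M"
      unfolding distrib_left using C C' by (intro add_mono) auto
    finally show ?thesis by (simp add: add_divide_distrib)
  qed
  then show ?case by blast
next
  case (scale Q c)
  obtain C where C: "\<forall>M t. \<bar>t\<bar> ^ j * norm (Q M t) \<le> C / 2 ^ M" using scale.IH by blast
  have "\<bar>t\<bar> ^ j * norm (c * Q M t) \<le> (norm c * C) / 2 ^ M" for M t
    using mult_left_mono[OF C[rule_format, of t M], of "norm c"] by (simp add: norm_mult algebra_simps)
  then show ?case by blast
qed

lemma remainder_span_deriv: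
  "remainder_span s Q \<Longrightarrow> \<exists>Q'. remainder_span s Q' \<and> (\<forall>M t. (Q M has_vector_derivative Q' M t) (at t))"
proof (induction rule: remainder_span.induct)
  case base
  have "remainder_span s (\<lambda>M t. (- 2 * of_real pi) * (of_real t * hermite_rem s M t) + (- 4 * of_real pi * s) * hermite_rem s (M - 1) t)"
    by (intro remainder_span.intros)
  moreover have "(hermite_rem s M has_vector_derivative (- 2 * of_real pi) * (of_real t * hermite_rem s M t) + (- 4 * of_real pi * s) * hermite_rem s (M - 1) t) (at t)" for M t
    using hermite_rem_deriv[of s M t] by simp
  ultimately show ?case by blast
next
  case (times Q)
  then obtain Q' where Q': "remainder_span s Q'" "\<And>M t. (Q M has_vector_derivative Q' M t) (at t)" by blast
  have "remainder_span s (\<lambda>M t. of_real t * Q' M t + Q M t)"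
    by (intro remainder_span.intros Q' times)
  moreover have "((\<lambda>t. of_real t * Q M t) has_vector_derivative of_real t * Q' M t + Q M t) (at t)" for M t
    using has_vector_derivative_mult[OF has_vector_derivative_of_real[OF DERIV_ident] Q'(2)[of M t]]
    by simp
  ultimately show ?case by blast
next
  case (shift Q)
  then obtain Q' where "remainder_span s Q'" "\<And>M t. (Q M has_vector_derivative Q' M t) (at t)" by blast
  then show ?case
    by (intro exI[of _ "\<lambda>M. Q' (M - 1)"]) (auto simp del: One_nat_def intro: remainder_span.shift)
next
  case (add Q Q')
  then obtain P P' where "remainder_span s P" "\<And>M t. (Q M has_vector_derivative P M t) (at t)"
    "remainder_span s P'" "\<And>M t. (Q' M has_vector_derivative P' M t) (at t)" by blast
  then show ?case
    by (intro exI[of _ "\<lambda>M t. P M t + P' M t"]) (auto intro: remainder_span.intros has_vector_derivative_add)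
next
  case (scale Q c)
  then obtain P where "remainder_span s P" "\<And>M t. (Q M has_vector_derivative P M t) (at t)" by blast
  then show ?case
    by (intro exI[of _ "\<lambda>M t. c * P M t"]) (auto intro: remainder_span.intros has_vector_derivative_mult_right)
qed

text \<open>Iterated derivatives may be read off from any chain of successive derivatives.\<close>

lemma iter_vderiv_eqI:
  assumes "g 0 = f" and "\<And>k t. (g k has_vector_derivative g (Suc k) t) (at t)"
  shows "iter_vderiv k f = g k"
proof (induction k)
  case 0
  then show ?case by (simp add: iter_vderiv_def assms)
next
  case (Suc k)
  have "iter_vderiv (Suc k) f = (\<lambda>x. vector_derivative (iter_vderiv k f) (at x))"
    by (simp add: iter_vderiv_def)
  then show ?case unfolding Suc using assms(2) by (auto simp: vector_derivative_at)
qed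

lemma iter_vderiv_schwartz:
  assumes "g \<in> schwartz_space"
  shows "(iter_vderiv k g has_vector_derivative iter_vderiv (Suc k) g t) (at t)"
proof -
  have "iter_vderiv k g differentiable (at t)" using assms by (simp add: schwartz_space_def)
  then show ?thesis by (simp add: vector_derivative_works iter_vderiv_def)
qed

lemma schwartz_bdd: "g \<in> schwartz_space \<Longrightarrow> \<exists>C. \<forall>t. \<bar>t\<bar> ^ j * norm (iter_vderiv k g t) \<le> C"
  unfolding schwartz_space_def bdd_above_def by auto

lemma schwartz_spaceI:
  assumes "\<And>k t. (iter_vderiv k g has_vector_derivative g' k t) (at t)"
    and "\<And>j k. \<exists>C. \<forall>t. \<bar>t\<bar> ^ j * norm (iter_vderiv k g t) \<le> C"
  shows "g \<in> schwartz_space"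
proof -
  have "iter_vderiv k g differentiable (at t)" for k t using assms(1) differentiableI_vector by blast
  then show ?thesis using assms(2) unfolding schwartz_space_def bdd_above_def by fastforce
qed

lemma schwartz_add:
  assumes "g \<in> schwartz_space" "h \<in> schwartz_space"
  shows "(\<lambda>t. g t + h t) \<in> schwartz_space"
proof -
  have eq: "iter_vderiv k (\<lambda>t. g t + h t) = (\<lambda>t. iter_vderiv k g t + iter_vderiv k h t)" for k
    by (rule iter_vderiv_eqI[where g = "\<lambda>k t. iter_vderiv k g t + iter_vderiv k h t"])
       (auto intro!: has_vector_derivative_add iter_vderiv_schwartz assms simp: iter_vderiv_def[of 0])
  show ?thesis
  proof (rule schwartz_spaceI)
    show "(iter_vderiv k (\<lambda>t. g t + h t) has_vector_derivative iter_vderiv (Suc k) g t + iter_vderiv (Suc k) h t) (at t)" for k t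
      unfolding eq by (auto intro!: has_vector_derivative_add iter_vderiv_schwartz assms)
    show "\<exists>C. \<forall>t. \<bar>t\<bar> ^ j * norm (iter_vderiv k (\<lambda>t. g t + h t) t) \<le> C" for j k
    proof -
      obtain C where C: "\<And>t. \<bar>t\<bar> ^ j * norm (iter_vderiv k g t) \<le> C" using schwartz_bdd assms(1) by blast
      obtain D where D: "\<And>t. \<bar>t\<bar> ^ j * norm (iter_vderiv k h t) \<le> D" using schwartz_bdd assms(2) by blast
      have "\<bar>t\<bar> ^ j * norm (iter_vderiv k g t + iter_vderiv k h t) \<le> C + D" for t
        using mult_left_mono[OF norm_triangle_ineq[of "iter_vderiv k g t" "iter_vderiv k h t"], of "\<bar>t\<bar> ^ j"] C[of t] D[of t]
        by (simp add: distrib_left)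
      then show ?thesis unfolding eq by blast
    qed
  qed
qed

lemma schwartz_scale:
  assumes "g \<in> schwartz_space"
  shows "(\<lambda>t. c * g t) \<in> schwartz_space"
proof -
  have eq: "iter_vderiv k (\<lambda>t. c * g t) = (\<lambda>t. c * iter_vderiv k g t)" for k
    by (rule iter_vderiv_eqI[where g = "\<lambda>k t. c * iter_vderiv k g t"])
       (auto intro!: has_vector_derivative_mult_right iter_vderiv_schwartz assms simp: iter_vderiv_def[of 0])
  show ?thesis
  proof (rule schwartz_spaceI)
    show "(iter_vderiv k (\<lambda>t. c * g t) has_vector_derivative c * iter_vderiv (Suc k) g t) (at t)" for k t
      unfolding eq by (auto intro!: has_vector_derivative_mult_right iter_vderiv_schwartz assms)
    show "\<exists>C. \<forall>t. \<bar>t\<bar> ^ j * norm (iter_vderiv k (\<lambda>t. c * g t) t) \<le> C" for j k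
    proof -
      obtain C where C: "\<And>t. \<bar>t\<bar> ^ j * norm (iter_vderiv k g t) \<le> C" using schwartz_bdd assms(1) by blast
      have "\<bar>t\<bar> ^ j * norm (c * iter_vderiv k g t) \<le> norm c * C" for t
        using mult_left_mono[OF C[of t], of "norm c"] by (simp add: norm_mult algebra_simps)
      then show ?thesis unfolding eq by blast
    qed
  qed
qed

lemma remainder_span_schwartz:
  assumes "remainder_span s Q"
  shows "Q M \<in> schwartz_space" and "\<exists>C. \<forall>M. schwartz_seminorm j k (Q M) \<le> C / 2 ^ M"
proof -
  have "\<exists>f. \<forall>k. remainder_span s (f k) \<and> (k = 0 \<longrightarrow> f k = Q) \<and>
      (\<forall>M t. (f k M has_vector_derivative f (Suc k) M t) (at t))"
    using dependent_nat_choice[where P = "\<lambda>k R. remainder_span s R \<and> (k = 0 \<longrightarrow> R = Q)"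
        and Q = "\<lambda>k R R'. \<forall>M t. (R M has_vector_derivative R' M t) (at t)"]
      assms remainder_span_deriv by (auto simp: conj_ac)
  then obtain f where f: "\<And>k. remainder_span s (f k)" "f 0 = Q"
      "\<And>k M t. (f k M has_vector_derivative f (Suc k) M t) (at t)" by metis
  have eq: "iter_vderiv k (Q M) = f k M" for k M
    by (rule iter_vderiv_eqI[where g = "\<lambda>k. f k M"]) (auto simp: f)
  have bd: "\<exists>C. \<forall>M t. \<bar>t\<bar> ^ j * norm (iter_vderiv k (Q M) t) \<le> C / 2 ^ M" for j k
    unfolding eq by (rule remainder_span_bound[OF f(1)])
  show "Q M \<in> schwartz_space"
  proof (rule schwartz_spaceI)
    show "(iter_vderiv k (Q M) has_vector_derivative f (Suc k) M t) (at t)" for k t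
      unfolding eq by (rule f)
    show "\<exists>C. \<forall>t. \<bar>t\<bar> ^ j * norm (iter_vderiv k (Q M) t) \<le> C" for j k using bd by blast
  qed
  obtain C where "\<And>M t. \<bar>t\<bar> ^ j * norm (iter_vderiv k (Q M) t) \<le> C / 2 ^ M" using bd by blast
  then have "schwartz_seminorm j k (Q M) \<le> C / 2 ^ M" for M
    unfolding schwartz_seminorm_def by (intro cSUP_least) auto
  then show "\<exists>C. \<forall>M. schwartz_seminorm j k (Q M) \<le> C / 2 ^ M" by blast
qed

lemma hermite_gen_schwartz: "hermite_gen s \<in> schwartz_space"
  using remainder_span_schwartz(1)[OF remainder_span.base, of s 0] by (simp add: hermite_rem_def[abs_def])

lemma hermite_term_schwartz: "hermite_term s n \<in> schwartz_space"
proof -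
  have "(\<lambda>t. hermite_rem s n t + (-1) * hermite_rem s (Suc n) t) \<in> schwartz_space"
    by (intro schwartz_add schwartz_scale remainder_span_schwartz(1)[OF remainder_span.base])
  then show ?thesis by (simp add: hermite_rem_def)
qed

lemma hermite_raw_schwartz: "(\<lambda>t. of_real (hermite_raw n t)) \<in> schwartz_space"
  using schwartz_scale[OF hermite_term_schwartz[of 1 n], of "fact n"] by (simp add: hermite_term_def)

text \<open>The generating series converges in the Schwartz topology, hence it may be paired termwise with a
  tempered distribution.\<close>

lemma tempered_hermite_gen_sums:
  assumes "tempered_distribution T"
  shows "(\<lambda>n. T (\<lambda>t. of_real (hermite_raw n t)) / fact n * s ^ n) sums T (hermite_gen s)"
proof -
  have add: "\<And>g h. g \<in> schwartz_space \<Longrightarrow> h \<in> schwartz_space \<Longrightarrow> T (\<lambda>x. g x + h x) = T g + T h"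
    and scale: "\<And>c g. g \<in> schwartz_space \<Longrightarrow> T (\<lambda>x. c * g x) = c * T g"
    and cont: "\<And>g \<epsilon>. g \<in> schwartz_space \<Longrightarrow> \<epsilon> > 0 \<Longrightarrow> \<exists>m. \<exists>\<delta>>0. \<forall>h\<in>schwartz_space.
        (\<forall>j\<le>m. \<forall>k\<le>m. schwartz_seminorm j k (\<lambda>x. h x - g x) < \<delta>) \<longrightarrow> norm (T h - T g) < \<epsilon>"
    using assms unfolding tempered_distribution_def by blast+
  have Tterm: "T (hermite_term s n) = T (\<lambda>t. of_real (hermite_raw n t)) / fact n * s ^ n" for n
    unfolding hermite_term_def[abs_def] by (subst scale[OF hermite_raw_schwartz]) simp
  define S where "S M = (\<lambda>t. \<Sum>n<M. hermite_term s n t)" for M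
  have S: "S M \<in> schwartz_space \<and> T (S M) = (\<Sum>n<M. T (hermite_term s n))" for M
  proof (induction M)
    case 0
    show ?case
      using schwartz_scale[OF hermite_gen_schwartz, of 0 s] scale[OF hermite_gen_schwartz, of 0 s]
      by (simp add: S_def)
  next
    case (Suc M)
    have "S (Suc M) = (\<lambda>t. S M t + hermite_term s M t)" by (simp add: S_def)
    then show ?case using Suc hermite_term_schwartz add schwartz_add by simp
  qed
  have "(\<lambda>M. T (S M)) \<longlonglongrightarrow> T (hermite_gen s)"
  proof (rule LIMSEQ_I)
    fix \<epsilon> :: real assume "\<epsilon> > 0"
    then obtain m \<delta> where \<delta>: "\<delta> > 0" and close: "\<And>h. h\<in>schwartz_space \<Longrightarrow>
        (\<And>j k. j \<le> m \<Longrightarrow> k \<le> m \<Longrightarrow> schwartz_seminorm j k (\<lambda>x. h x - hermite_gen s x) < \<delta>) \<Longrightarrow> norm (T h - T (hermite_gen s)) < \<epsilon>"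
      using cont[OF hermite_gen_schwartz] by metis
    have span: "remainder_span s (\<lambda>M t. (-1) * hermite_rem s M t)" by (intro remainder_span.intros)
    have diff: "(\<lambda>x. S M x - hermite_gen s x) = (\<lambda>t. (-1) * hermite_rem s M t)" for M
      by (simp add: S_def hermite_rem_def)
    have "eventually (\<lambda>M. schwartz_seminorm j k (\<lambda>x. S M x - hermite_gen s x) < \<delta>) sequentially" for j k
    proof -
      obtain C where C: "\<And>M. schwartz_seminorm j k (\<lambda>t. (-1) * hermite_rem s M t) \<le> C / 2 ^ M"
        using remainder_span_schwartz(2)[OF span] by blast
      have "(\<lambda>M. C / 2 ^ M) \<longlonglongrightarrow> 0" by (intro LIMSEQ_divide_realpow_zero) auto
      then have "eventually (\<lambda>M. C / 2 ^ M < \<delta>) sequentially" using \<delta> order_tendstoD(2) by blast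
      then show ?thesis by eventually_elim (use C diff in \<open>metis le_less_trans\<close>)
    qed
    then have "eventually (\<lambda>M. \<forall>j\<in>{..m}. \<forall>k\<in>{..m}. schwartz_seminorm j k (\<lambda>x. S M x - hermite_gen s x) < \<delta>) sequentially"
      by (intro eventually_ball_finite ballI) auto
    then obtain M0 where "\<And>M. M \<ge> M0 \<Longrightarrow> \<forall>j\<in>{..m}. \<forall>k\<in>{..m}. schwartz_seminorm j k (\<lambda>x. S M x - hermite_gen s x) < \<delta>"
      unfolding eventually_sequentially by blast
    then show "\<exists>no. \<forall>M\<ge>no. norm (T (S M) - T (hermite_gen s)) < \<epsilon>"
      using close S by (meson atMost_iff)
  qed
  then show ?thesis unfolding sums_def using S Tterm by simp
qed

section \<open>Orthogonality and the moments of Bochner-Riesz means\<close>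

text \<open>One integrable majorant serves two purposes: with exponent \<open>1\<close> it dominates Schwartz functions, and
  with small exponents it dominates the rescaled convolution kernels.\<close>

lemma integrable_powr_decay:
  assumes "\<alpha> > 0"
  shows "integrable lborel (\<lambda>x::real. (1 + \<bar>x\<bar>) powr (- 1 - \<alpha>))"
proof -
  define g where "g x = (1 + \<bar>x\<bar>) powr (- 1 - \<alpha>)" for x :: real
  have meas [measurable]: "g \<in> borel_measurable borel" unfolding g_def by measurable
  have "(\<integral>\<^sup>+x. ennreal (g x) * indicator {0..} x \<partial>lborel) = ennreal (0 - (- 1 / \<alpha> * (1 + 0) powr (- \<alpha>)))"
  proof (rule nn_integral_FTC_atLeast[where F = "\<lambda>x. - 1 / \<alpha> * (1 + x) powr (- \<alpha>)"])
    show "((\<lambda>x. - 1 / \<alpha> * (1 + x) powr (- \<alpha>)) has_real_derivative g x) (at x)" if "0 \<le> x" for x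
    proof -
      have "((\<lambda>x. (1 + x) powr (- \<alpha>)) has_real_derivative - \<alpha> * (1 + x) powr (- 1 - \<alpha>)) (at x)"
        using that DERIV_fun_powr[of "\<lambda>x. 1 + x" 1 x "- \<alpha>"]
        by (auto intro!: derivative_eq_intros simp: minus_diff_commute)
      from DERIV_cmult[OF this, of "- 1 / \<alpha>"] show ?thesis
        using that assms by (simp add: g_def)
    qed
    show "((\<lambda>x. - 1 / \<alpha> * (1 + x) powr (- \<alpha>)) \<longlongrightarrow> 0) at_top"
      using assms by (intro tendsto_mult_right_zero tendsto_neg_powr filterlim_tendsto_add_at_top[OF tendsto_const filterlim_ident]) auto
  qed (auto simp: g_def)
  then have fin: "(\<integral>\<^sup>+x. ennreal (g x) * indicator {0..} x \<partial>lborel) < \<infinity>" by simp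
  have "(\<integral>\<^sup>+x. ennreal (g x) * indicator {..0} x \<partial>lborel)
      = (\<integral>\<^sup>+x. ennreal (g x) * indicator {0..} x \<partial>lborel)"
    by (subst nn_integral_real_affine[where c = "-1" and t = 0])
       (auto simp: g_def indicator_def intro!: nn_integral_cong)
  moreover have "(\<integral>\<^sup>+x. ennreal (g x) \<partial>lborel)
      \<le> (\<integral>\<^sup>+x. ennreal (g x) * indicator {0..} x + ennreal (g x) * indicator {..0} x \<partial>lborel)"
    by (intro nn_integral_mono) (auto simp: indicator_def)
  moreover have "\<dots> = (\<integral>\<^sup>+x. ennreal (g x) * indicator {0..} x \<partial>lborel)
      + (\<integral>\<^sup>+x. ennreal (g x) * indicator {..0} x \<partial>lborel)"
    by (intro nn_integral_add) auto
  ultimately have "(\<integral>\<^sup>+x. ennreal (g x) \<partial>lborel) < \<infinity>"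
    using fin by (metis ennreal_add_less_top infinity_ennreal_def order_le_less_trans)
  then have "integrable lborel g"
    by (intro integrableI_nonneg) (auto simp: g_def)
  then show ?thesis by (simp add: g_def[abs_def])
qed

lemma schwartz_continuous:
  assumes "g \<in> schwartz_space" shows "continuous_on A g"
proof -
  have "iter_vderiv 0 g differentiable (at t)" for t using assms unfolding schwartz_space_def by blast
  then have "isCont g t" for t
    using differentiable_imp_continuous_within[of g _ UNIV] by (simp add: iter_vderiv_def)
  then show ?thesis by (simp add: continuous_at_imp_continuous_on)
qed

lemma schwartz_measurable:
  assumes "g \<in> schwartz_space" shows "g \<in> borel_measurable lborel"
  using borel_measurable_continuous_onI[OF schwartz_continuous[OF assms]] by simp

lemma schwartz_decay:
  assumes "g \<in> schwartz_space" shows "\<exists>C. \<forall>t. \<bar>t\<bar> ^ j * norm (g t) \<le> C"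
  using schwartz_bdd[OF assms, of j 0] by (simp add: iter_vderiv_def)

lemma schwartz_integrable:
  assumes "g \<in> schwartz_space" shows "integrable lborel g"
proof -
  obtain A where A: "\<And>t. \<bar>t\<bar> ^ 0 * norm (g t) \<le> A" using schwartz_decay[OF assms] by blast
  obtain B where B: "\<And>t. \<bar>t\<bar> ^ 2 * norm (g t) \<le> B" using schwartz_decay[OF assms] by blast
  have "integrable lborel (\<lambda>t::real. (2 * (A + B)) * (1 + \<bar>t\<bar>) powr (- 1 - 1))"
    by (intro integrable_mult_right integrable_powr_decay) simp
  moreover have "norm (g t) \<le> norm ((2 * (A + B)) * (1 + \<bar>t\<bar>) powr (- 1 - 1))" for t
  proof -
    have "0 \<le> (1 - \<bar>t\<bar>)\<^sup>2" by simp
    then have "(1 + \<bar>t\<bar>)\<^sup>2 \<le> 2 * (1 + t\<^sup>2)" by (simp add: power2_eq_square algebra_simps)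
    then have "norm (g t) * (1 + \<bar>t\<bar>)\<^sup>2 \<le> norm (g t) * (2 * (1 + t\<^sup>2))" by (intro mult_left_mono) auto
    also have "\<dots> \<le> 2 * (A + B)" using A[of t] B[of t] by (simp add: algebra_simps)
    finally have "norm (g t) \<le> 2 * (A + B) / (1 + \<bar>t\<bar>)\<^sup>2"
      by (simp add: pos_le_divide_eq add_pos_nonneg)
    also have "\<dots> = (2 * (A + B)) * (1 + \<bar>t\<bar>) powr (- 1 - 1)"
      using powr_numeral[of "1 + \<bar>t\<bar>" "num.Bit0 num.One"] by (simp add: powr_minus_divide)
    finally show ?thesis by simp
  qed
  ultimately show ?thesis
    by (rule Bochner_Integration.integrable_bound[OF _ schwartz_measurable[OF assms] AE_I2])
qed

lemma schwartz_mult_integrable: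
  assumes "g \<in> schwartz_space" "h \<in> schwartz_space"
  shows "integrable lborel (\<lambda>t. g t * h t)"
proof -
  obtain A where A: "\<And>t. norm (h t) \<le> A" using schwartz_decay[OF assms(2), of 0] by auto
  have "integrable lborel (\<lambda>t. A * norm (g t))" using schwartz_integrable[OF assms(1)] by simp
  moreover have "norm (g t * h t) \<le> norm (A * norm (g t))" for t
  proof -
    have "norm (h t) * norm (g t) \<le> A * norm (g t)" by (intro mult_right_mono A) auto
    then show ?thesis by (simp add: norm_mult mult.commute)
  qed
  ultimately show ?thesis
    by (rule Bochner_Integration.integrable_bound[OF _
        borel_measurable_times[OF schwartz_measurable[OF assms(1)] schwartz_measurable[OF assms(2)]] AE_I2])
qed

lemma schwartz_tendsto_0:
  assumes "g \<in> schwartz_space"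
  shows "(g \<longlongrightarrow> 0) at_infinity"
proof -
  obtain A where A: "\<And>t. \<bar>t\<bar> ^ 1 * norm (g t) \<le> A" using schwartz_decay[OF assms] by blast
  show ?thesis
  proof (rule Lim_null_comparison)
    show "\<forall>\<^sub>F t in at_infinity. norm (g t) \<le> A * norm (inverse t)"
    proof -
      have "norm (g t) \<le> A * norm (inverse t)" if "1 \<le> norm t" for t
        using A[of t] that by (simp add: field_simps)
      then show ?thesis unfolding eventually_at_infinity by blast
    qed
    show "((\<lambda>t::real. A * norm (inverse t)) \<longlongrightarrow> 0) at_infinity"
      by (intro tendsto_mult_right_zero tendsto_norm_zero tendsto_inverse_0)
  qed
qed

lemma integral_derivative_eq_0:
  fixes F f :: "real \<Rightarrow> real"
  assumes "\<And>t. (F has_real_derivative f t) (at t)" "continuous_on UNIV f" "integrable lborel f"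
    and "(F \<longlongrightarrow> 0) at_infinity"
  shows "(LINT t|lborel. f t) = 0"
proof -
  have bot: "(F \<longlongrightarrow> 0) at_bot" and top: "(F \<longlongrightarrow> 0) at_top"
    using assms(4) at_bot_le_at_infinity at_top_le_at_infinity tendsto_mono by blast+
  have "(LBINT t=-\<infinity>..\<infinity>. f t) = 0 - 0"
  proof (rule interval_integral_FTC_integrable[where F = F])
    show "set_integrable lborel (einterval (-\<infinity>) \<infinity>) f" using assms(3) by (simp add: set_integrable_def)
  qed (use assms bot top in \<open>auto simp: has_real_derivative_iff_has_vector_derivative[symmetric]
        continuous_on_eq_continuous_at ereal_tendsto_simps\<close>)
  then show ?thesis by (simp add: interval_lebesgue_integral_def set_lebesgue_integral_def)
qed

definition hermite_inner :: "nat \<Rightarrow> nat \<Rightarrow> real" where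
  "hermite_inner n m = (LINT t|lborel. hermite_raw n t * hermite_raw m t)"

lemma hermite_raw_continuous: "continuous_on A (hermite_raw n)"
  by (rule DERIV_continuous_on) (rule has_field_derivative_at_within, rule hermite_raw_deriv)

lemma hermite_raw_mult_integrable: "integrable lborel (\<lambda>t. hermite_raw n t * hermite_raw m t)"
proof -
  have "integrable lborel (\<lambda>t. complex_of_real (hermite_raw n t * hermite_raw m t))"
    using schwartz_mult_integrable[OF hermite_raw_schwartz hermite_raw_schwartz, of n m] by simp
  then show ?thesis using integrable_Re by fastforce
qed

text \<open>The difference of the two integrands is the derivative of a product of two Hermite functions, which
  vanishes at infinity: raising on one side is adjoint to lowering on the other.\<close>

lemma hermite_inner_ladder: "hermite_inner (Suc n) m = 4 * pi * real m * hermite_inner n (m - 1)"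
proof -
  define f where "f t = hermite_raw (Suc n) t * hermite_raw m t - 4 * pi * real m * (hermite_raw n t * hermite_raw (m - 1) t)" for t
  have "(LINT t|lborel. f t) = 0"
  proof (rule integral_derivative_eq_0)
    show "((\<lambda>t. hermite_raw n t * hermite_raw m t) has_real_derivative f t) (at t)" for t
      by (rule DERIV_cong[OF DERIV_mult[OF hermite_raw_deriv hermite_raw_deriv]])
         (simp add: f_def hermite_raw_rec algebra_simps)
    show "continuous_on UNIV f"
      unfolding f_def by (intro continuous_intros hermite_raw_continuous)
    show "integrable lborel f"
      unfolding f_def by (intro Bochner_Integration.integrable_diff integrable_mult_right hermite_raw_mult_integrable)
    have "((\<lambda>t. complex_of_real (hermite_raw k t)) \<longlongrightarrow> 0) at_infinity" for k
      by (rule schwartz_tendsto_0[OF hermite_raw_schwartz])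
    then have "((\<lambda>t. hermite_raw k t) \<longlongrightarrow> 0) at_infinity" for k
      using tendsto_Re[of "\<lambda>t. complex_of_real (hermite_raw k t)" 0 at_infinity] by simp
    then show "((\<lambda>t. hermite_raw n t * hermite_raw m t) \<longlongrightarrow> 0) at_infinity"
      by (intro tendsto_mult_zero)
  qed
  then show ?thesis
    unfolding f_def hermite_inner_def
    by (subst (asm) Bochner_Integration.integral_diff)
       (auto intro!: hermite_raw_mult_integrable integrable_mult_right)
qed

lemma hermite_inner_sym: "hermite_inner n m = hermite_inner m n"
  unfolding hermite_inner_def by (simp add: mult.commute)

lemma hermite_inner_orthogonal:
  assumes "n \<noteq> m" shows "hermite_inner n m = 0"
proof -
  have "hermite_inner n m = 0" if "m < n" for n m
    using that
  proof (induction m arbitrary: n)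
    case 0
    then show ?case using hermite_inner_ladder[of "n - 1" 0] by simp
  next
    case (Suc m)
    then show ?case using hermite_inner_ladder[of "n - 1" "Suc m"] by simp
  qed
  then show ?thesis using assms hermite_inner_sym by (metis nat_neq_iff)
qed

lemma hermite_inner_pos: "hermite_inner n n > 0"
proof (induction n)
  case 0
  have "hermite_inner 0 0 \<ge> 0" unfolding hermite_inner_def by (intro integral_nonneg_AE) auto
  moreover have "hermite_inner 0 0 \<noteq> 0"
  proof
    assume "hermite_inner 0 0 = 0"
    then have "AE t in lborel. hermite_raw 0 t * hermite_raw 0 t = 0"
      unfolding hermite_inner_def
      by (subst (asm) integral_nonneg_eq_0_iff_AE) (auto intro: hermite_raw_mult_integrable)
    then have "AE t::real in lborel. False" by (simp add: hermite_raw_0)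
    then show False by (simp add: AE_iff_measurable[of UNIV])
  qed
  ultimately show ?case by simp
next
  case (Suc n)
  then show ?case using hermite_inner_ladder[of n "Suc n"] by simp
qed

lemma sgn_power_neg1: "sgn ((- 1 :: real) ^ n) = (- 1) ^ n"
  by (cases "even n") auto

text \<open>The normalising constant enters the Bochner-Riesz means only through its square, and that square
  cancels the squared norm left over by orthogonality.\<close>

lemma hermite_const_sq: "(hermite_const n)\<^sup>2 * hermite_inner n n = 1"
proof -
  have L2: "L2_norm (\<lambda>t. c * hermite_raw n t) = \<bar>c\<bar> * sqrt (hermite_inner n n)" for c
  proof -
    have "(LINT t|lborel. \<bar>c * hermite_raw n t\<bar>\<^sup>2) = c\<^sup>2 * hermite_inner n n"
      unfolding hermite_inner_def integral_mult_right_zero[symmetric]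
      by (simp add: power_mult_distrib power2_eq_square algebra_simps)
    then show ?thesis unfolding L2_norm_def by (simp add: real_sqrt_mult)
  qed
  define c0 where "c0 = (-1) ^ n / sqrt (hermite_inner n n)"
  have s: "sqrt (hermite_inner n n) > 0" using hermite_inner_pos by simp
  have "hermite_const n = c0"
    unfolding hermite_const_def L2
  proof (rule the_equality)
    show "sgn c0 = (- 1) ^ n \<and> \<bar>c0\<bar> * sqrt (hermite_inner n n) = 1"
      using s by (simp add: c0_def sgn_divide abs_divide power_abs sgn_power_neg1)
    fix c assume c: "sgn c = (- 1) ^ n \<and> \<bar>c\<bar> * sqrt (hermite_inner n n) = 1"
    then have "\<bar>c\<bar> = 1 / sqrt (hermite_inner n n)" using s by (simp add: field_simps)
    then show "c = c0" using c mult_sgn_abs[of c] by (simp add: c0_def)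
  qed
  then show ?thesis using s hermite_inner_pos[of n] by (simp add: c0_def power_divide power_mult[symmetric] mult.commute)
qed

lemma schwartz_seminorm_0_upper:
  assumes "g \<in> schwartz_space"
  shows "norm (g t) \<le> schwartz_seminorm 0 0 g"
proof -
  have "\<forall>j k. bdd_above (range (\<lambda>x. \<bar>x\<bar> ^ j * norm (iter_vderiv k g x)))"
    using assms by (simp add: schwartz_space_def)
  from cSUP_upper[OF UNIV_I this[rule_format, of 0 0], of t] show ?thesis by (simp add: schwartz_seminorm_def iter_vderiv_def)
qed

lemma distribution_of_tempered:
  assumes u: "u \<in> schwartz_space"
  shows "tempered_distribution (distribution_of u)"
  unfolding tempered_distribution_def
proof (intro conjI ballI allI impI)
  fix g h assume "g \<in> schwartz_space" "h \<in> schwartz_space"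
  then show "distribution_of u (\<lambda>x. g x + h x) = distribution_of u g + distribution_of u h"
    unfolding distribution_of_def distrib_left
    by (intro Bochner_Integration.integral_add schwartz_mult_integrable u)
next
  fix c g
  show "distribution_of u (\<lambda>x. c * g x) = c * distribution_of u g"
    unfolding distribution_of_def integral_mult_right_zero[symmetric] by (simp add: mult.left_commute)
next
  fix g and \<epsilon> :: real assume g: "g \<in> schwartz_space" and \<epsilon>: "\<epsilon> > 0"
  define I where "I = (LINT t|lborel. norm (u t))"
  have I: "I \<ge> 0" unfolding I_def by (intro integral_nonneg_AE) auto
  show "\<exists>m. \<exists>\<delta>>0. \<forall>h\<in>schwartz_space.
        (\<forall>j\<le>m. \<forall>k\<le>m. schwartz_seminorm j k (\<lambda>x. h x - g x) < \<delta>) \<longrightarrow> norm (distribution_of u h - distribution_of u g) < \<epsilon>"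
  proof (rule exI[of _ 0], rule exI[of _ "\<epsilon> / (I + 1)"], intro conjI ballI impI)
    show "\<epsilon> / (I + 1) > 0" using I \<epsilon> by simp
    fix h assume h: "h \<in> schwartz_space"
      and "\<forall>j\<le>0. \<forall>k\<le>0. schwartz_seminorm j k (\<lambda>x. h x - g x) < \<epsilon> / (I + 1)"
    then have small: "schwartz_seminorm 0 0 (\<lambda>x. h x - g x) < \<epsilon> / (I + 1)" by simp
    have d: "(\<lambda>x. h x - g x) \<in> schwartz_space"
      using schwartz_add[OF h schwartz_scale[OF g, of "-1"]] by simp
    have bd: "norm (h t - g t) \<le> \<epsilon> / (I + 1)" for t
      using schwartz_seminorm_0_upper[OF d, of t] small by linarith
    have "distribution_of u h - distribution_of u g = (LINT t|lborel. u t * (h t - g t))"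
      unfolding distribution_of_def right_diff_distrib
      by (intro Bochner_Integration.integral_diff[symmetric] schwartz_mult_integrable u g h)
    also have "norm \<dots> \<le> (LINT t|lborel. norm (u t) * (\<epsilon> / (I + 1)))"
    proof (rule Bochner_Integration.integral_norm_bound_integral)
      show "integrable lborel (\<lambda>t. norm (u t) * (\<epsilon> / (I + 1)))"
        using schwartz_integrable[OF u] by simp
      show "norm (u t * (h t - g t)) \<le> norm (u t) * (\<epsilon> / (I + 1))" for t
        unfolding norm_mult by (intro mult_left_mono bd) auto
    qed (rule schwartz_mult_integrable[OF u d])
    also have "\<dots> = \<epsilon> * (I / (I + 1))" by (simp add: I_def)
    also have "\<dots> < \<epsilon>" using I \<epsilon> by (simp add: field_simps)
    finally show "norm (distribution_of u h - distribution_of u g) < \<epsilon>" .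
  qed
qed

lemma schwartz_sum:
  assumes "\<And>i. i \<in> A \<Longrightarrow> g i \<in> schwartz_space"
  shows "(\<lambda>t. \<Sum>i\<in>A. g i t) \<in> schwartz_space"
proof -
  have zero: "(\<lambda>t. 0) \<in> schwartz_space"
    using schwartz_scale[OF hermite_gen_schwartz, of 0 0] by simp
  show ?thesis using assms
    by (induction A rule: infinite_finite_induct) (auto intro: zero schwartz_add)
qed

text \<open>Extension of the Bochner-Riesz coefficients by zero beyond \<open>N\<close>; in this form they are a multiplier on
  full power series.\<close>

definition riesz_weight :: "real \<Rightarrow> nat \<Rightarrow> nat \<Rightarrow> real" where
  "riesz_weight \<alpha> N n = (if n \<le> N then (1 - (real n)\<^sup>2 / (real N)\<^sup>2) powr \<alpha> else 0)"

lemma pairing_hermite_fun: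
  assumes "tempered_distribution T"
  shows "pairing T (hermite_fun n) = of_real (hermite_const n) * T (\<lambda>t. of_real (hermite_raw n t))"
proof -
  have "(\<lambda>t. cnj (hermite_fun n t)) = (\<lambda>t. of_real (hermite_const n) * of_real (hermite_raw n t))"
    by (simp add: hermite_fun_def fun_eq_iff)
  then show ?thesis
    using assms hermite_raw_schwartz unfolding pairing_def tempered_distribution_def by metis
qed

lemma bochner_riesz_eq:
  assumes "tempered_distribution T"
  shows "bochner_riesz \<alpha> N T t = (\<Sum>n\<le>N. of_real (riesz_weight \<alpha> N n * (hermite_const n)\<^sup>2)
      * T (\<lambda>t. of_real (hermite_raw n t)) * of_real (hermite_raw n t))"
  unfolding bochner_riesz_def pairing_hermite_fun[OF assms] atLeast0AtMost
  by (intro sum.cong) (auto simp: riesz_weight_def hermite_fun_def power2_eq_square)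

lemma bochner_riesz_schwartz:
  assumes "tempered_distribution T"
  shows "bochner_riesz \<alpha> N T \<in> schwartz_space"
  unfolding bochner_riesz_eq[OF assms, abs_def]
  by (intro schwartz_sum schwartz_scale hermite_raw_schwartz)

text \<open>By orthogonality the means act diagonally on the Hermite moments of a distribution.\<close>

lemma bochner_riesz_moments:
  assumes "tempered_distribution T"
  shows "distribution_of (bochner_riesz \<alpha> N T) (\<lambda>t. of_real (hermite_raw m t))
    = of_real (riesz_weight \<alpha> N m) * T (\<lambda>t. of_real (hermite_raw m t))"
proof -
  define b where "b n = of_real (riesz_weight \<alpha> N n * (hermite_const n)\<^sup>2) * T (\<lambda>t. of_real (hermite_raw n t))" for n
  have int: "integrable lborel (\<lambda>t. complex_of_real (hermite_raw n t * hermite_raw m t))" for n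
    using hermite_raw_mult_integrable by (simp only: integrable_of_real)
  have "distribution_of (bochner_riesz \<alpha> N T) (\<lambda>t. of_real (hermite_raw m t))
     = (LINT t|lborel. (\<Sum>n\<le>N. b n * complex_of_real (hermite_raw n t * hermite_raw m t)))"
    unfolding distribution_of_def bochner_riesz_eq[OF assms] b_def
    by (simp add: sum_distrib_right mult.assoc)
  also have "\<dots> = (\<Sum>n\<le>N. (LINT t|lborel. b n * complex_of_real (hermite_raw n t * hermite_raw m t)))"
    by (intro Bochner_Integration.integral_sum integrable_mult_right int)
  also have "\<dots> = (\<Sum>n\<le>N. b n * of_real (hermite_inner n m))"
    unfolding hermite_inner_def integral_mult_right_zero integral_complex_of_real ..
  also have "\<dots> = (\<Sum>n\<in>{..N} \<inter> {m}. b n * of_real (hermite_inner n m))"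
    by (intro sum.mono_neutral_right) (auto simp: hermite_inner_orthogonal)
  also have "\<dots> = of_real (riesz_weight \<alpha> N m) * T (\<lambda>t. of_real (hermite_raw m t))"
  proof (cases "m \<le> N")
    case True
    have "complex_of_real ((hermite_const m)\<^sup>2) * of_real (hermite_inner m m) = 1"
      unfolding of_real_mult[symmetric] hermite_const_sq by simp
    moreover have "{..N} \<inter> {m} = {m}" using True by auto
    ultimately show ?thesis by (simp add: b_def mult_ac)
  qed (simp add: riesz_weight_def)
  finally show ?thesis .
qed

section \<open>The Bargmann transform\<close>

text \<open>The Bargmann picture of phase space: \<open>(x, \<omega>)\<close> corresponds to the complex number \<open>- (x - \<i> \<omega>) / 2\<close>,
  the factor \<open>- 1 / 2\<close> being dictated by the normalisation of the generating function.\<close>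

definition fock_point :: "real \<times> real \<Rightarrow> complex" where
  "fock_point z = Complex (- fst z / 2) (snd z / 2)"

definition fock_weight :: "real \<times> real \<Rightarrow> real" where
  "fock_weight z = 2 powr (1/4) * exp (- (pi / 2) * ((fst z)\<^sup>2 + (snd z)\<^sup>2))"

text \<open>Weighted entire functions, that is, elements of the Fock space up to normalisation.\<close>

definition fock :: "(nat \<Rightarrow> complex) \<Rightarrow> real \<times> real \<Rightarrow> complex" where
  "fock c z = of_real (fock_weight z) * (\<Sum>n. c n * fock_point z ^ n)"

definition hermite_coeff :: "((real \<Rightarrow> complex) \<Rightarrow> complex) \<Rightarrow> nat \<Rightarrow> complex" where
  "hermite_coeff T n = T (\<lambda>t. of_real (hermite_raw n t)) / fact n"

text \<open>The Bargmann transform: up to a unimodular factor, the short-time Fourier transform of a tempered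
  distribution with Gaussian window is the weighted power series of its Hermite moments. After conjugation
  the shifted Gaussian is a multiple of a generating function, and the exponents are compared directly.\<close>

lemma pairing_tf_shift:
  assumes "tempered_distribution T"
  shows "pairing T (tf_shift z gaussian_window)
    = exp (- \<i> * of_real (pi * fst z * snd z)) * fock (hermite_coeff T) z"
proof -
  obtain x w where z: "z = (x, w)" by (cases z)
  define a where "a = complex_of_real (fock_weight z) * exp (- \<i> * of_real (pi * fst z * snd z))"
  have s: "fock_point z = (of_real (- x) + \<i> * of_real w) / 2"
    by (simp add: fock_point_def z complex_eq_iff)
  have "cnj (tf_shift z gaussian_window t) = a * hermite_gen (fock_point z) t" for t
  proof -
    have "cnj (tf_shift z gaussian_window t) = of_real (2 powr (1/4)) *
       (exp (cnj (2 * of_real pi * \<i> * of_real w * of_real t)) * exp (of_real (- pi * (t - x)\<^sup>2)))"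
      unfolding tf_shift_def gaussian_window_def z complex_cnj_mult exp_cnj exp_of_real by simp
    also have "exp (cnj (2 * of_real pi * \<i> * of_real w * of_real t)) * exp (of_real (- pi * (t - x)\<^sup>2))
      = exp (of_real (- (pi / 2) * (x\<^sup>2 + w\<^sup>2))) * exp (- \<i> * of_real (pi * x * w)) * hermite_gen (fock_point z) t"
      unfolding hermite_gen_def s exp_add[symmetric]
      by (rule arg_cong[where f = exp]) (simp add: field_simps power2_eq_square)
    also have "exp (complex_of_real (- (pi / 2) * (x\<^sup>2 + w\<^sup>2))) = of_real (exp (- (pi / 2) * (x\<^sup>2 + w\<^sup>2)))"
      by (rule exp_of_real)
    finally show ?thesis
      unfolding a_def fock_weight_def z by (simp add: mult.assoc)
  qed
  then have "pairing T (tf_shift z gaussian_window) = T (\<lambda>t. a * hermite_gen (fock_point z) t)"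
    by (simp add: pairing_def)
  also have "\<dots> = a * T (hermite_gen (fock_point z))"
    using assms hermite_gen_schwartz unfolding tempered_distribution_def by blast
  also have "T (hermite_gen (fock_point z)) = (\<Sum>n. hermite_coeff T n * fock_point z ^ n)"
    using tempered_hermite_gen_sums[OF assms, of "fock_point z"] unfolding hermite_coeff_def
    by (simp add: sums_iff)
  finally show ?thesis by (simp add: a_def fock_def)
qed

definition entire_coeffs :: "(nat \<Rightarrow> complex) \<Rightarrow> bool" where
  "entire_coeffs c \<longleftrightarrow> (\<forall>s::complex. summable (\<lambda>n. norm (c n * s ^ n)))"

text \<open>The series in \<open>tempered_hermite_gen_sums\<close> converges at every complex parameter, so it converges
  absolutely everywhere.\<close>

lemma hermite_coeff_entire:
  assumes "tempered_distribution T" shows "entire_coeffs (hermite_coeff T)"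
  unfolding entire_coeffs_def
proof
  fix s :: complex
  have "summable (\<lambda>n. hermite_coeff T n * (of_real (norm s + 1)) ^ n)"
    using tempered_hermite_gen_sums[OF assms] unfolding hermite_coeff_def by (auto simp: sums_iff)
  moreover have "norm s < norm (complex_of_real (norm s + 1))" by (simp del: of_real_add)
  ultimately show "summable (\<lambda>n. norm (hermite_coeff T n * s ^ n))" by (rule powser_insidea)
qed

section \<open>Riesz kernels on the circle\<close>

definition dirichlet_kernel :: "nat \<Rightarrow> real \<Rightarrow> real" where
  "dirichlet_kernel n \<theta> = 1 + 2 * (\<Sum>j=1..n. cos (real j * \<theta>))"

lemma sin_half_dirichlet_kernel:
  "sin (\<theta> / 2) * dirichlet_kernel n \<theta> = sin ((real n + 1/2) * \<theta>)"
proof (induction n)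
  case 0
  show ?case by (simp add: dirichlet_kernel_def)
next
  case (Suc n)
  have "2 * (sin (\<theta> / 2) * cos (real (Suc n) * \<theta>))
      = sin ((real (Suc n) + 1/2) * \<theta>) - sin ((real n + 1/2) * \<theta>)"
    using sin_diff_sin[of "(real (Suc n) + 1/2) * \<theta>" "(real n + 1/2) * \<theta>"]
    by (simp add: algebra_simps add_divide_distrib)
  then show ?case using Suc by (simp add: dirichlet_kernel_def algebra_simps)
qed

lemma sin_half_sum_sin:
  "sin (\<theta> / 2) * (\<Sum>n<M. sin ((real n + 1/2) * \<theta>)) = (1 - cos (real M * \<theta>)) / 2"
proof (induction M)
  case (Suc M)
  have "2 * (sin (\<theta> / 2) * sin ((real M + 1/2) * \<theta>)) = cos (real M * \<theta>) - cos (real (Suc M) * \<theta>)"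
    using cos_diff_cos[of "real M * \<theta>" "real (Suc M) * \<theta>"]
    by (simp add: algebra_simps add_divide_distrib)
  then show ?case using Suc by (simp add: algebra_simps)
qed simp

lemma dirichlet_kernel_minus: "dirichlet_kernel n (- \<theta>) = dirichlet_kernel n \<theta>"
  by (simp add: dirichlet_kernel_def)

lemma dirichlet_kernel_abs: "dirichlet_kernel n \<bar>\<theta>\<bar> = dirichlet_kernel n \<theta>"
  by (cases "\<theta> \<ge> 0") (auto simp: dirichlet_kernel_minus)

lemma dirichlet_kernel_bound: "\<bar>dirichlet_kernel n \<theta>\<bar> \<le> 1 + 2 * real n"
proof -
  have "\<bar>\<Sum>j=1..n. cos (real j * \<theta>)\<bar> \<le> (\<Sum>j=1..n. 1)"
    by (rule order_trans[OF sum_abs sum_mono]) simp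
  then show ?thesis unfolding dirichlet_kernel_def by simp
qed

text \<open>Summation by parts for an increasing weight against bounded, nonnegative partial sums. The
  two-sided bound by \<open>d M * S\<close> and \<open>d M * (S - B)\<close>, with \<open>S\<close> the partial sum, is what passes through the induction.\<close>

lemma abel_sum_bound:
  fixes d s :: "nat \<Rightarrow> real"
  assumes nonneg: "\<And>n. 0 \<le> d n" and mono: "\<And>n. n < M \<Longrightarrow> d n \<le> d (Suc n)"
    and S: "\<And>k. 0 \<le> (\<Sum>n<k. s n)" "\<And>k. (\<Sum>n<k. s n) \<le> B"
  shows "\<bar>\<Sum>n<M. d n * s n\<bar> \<le> B * d M"
proof -
  have B: "0 \<le> B" using S(2)[of 0] by simp
  have "d M * ((\<Sum>n<M. s n) - B) \<le> (\<Sum>n<M. d n * s n)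
      \<and> (\<Sum>n<M. d n * s n) \<le> d M * (\<Sum>n<M. s n)"
    using mono
  proof (induction M)
    case 0
    then show ?case using B nonneg[of 0] by simp
  next
    case (Suc M)
    have IH: "d M * ((\<Sum>n<M. s n) - B) \<le> (\<Sum>n<M. d n * s n)"
        "(\<Sum>n<M. d n * s n) \<le> d M * (\<Sum>n<M. s n)"
      using Suc by auto
    have dM: "d M \<le> d (Suc M)" using Suc.prems by simp
    have "d (Suc M) * ((\<Sum>n<Suc M. s n) - B) \<le> d M * ((\<Sum>n<Suc M. s n) - B)"
      using dM S(2)[of "Suc M"] by (intro mult_right_mono_neg) auto
    moreover have "d M * (\<Sum>n<Suc M. s n) \<le> d (Suc M) * (\<Sum>n<Suc M. s n)"
      using dM S(1)[of "Suc M"] by (intro mult_right_mono) auto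
    ultimately show ?case using IH by (simp add: algebra_simps)
  qed
  moreover have "d M * (\<Sum>n<M. s n) \<le> d M * B" using S(2) nonneg by (intro mult_left_mono) auto
  moreover have "d M * (0 - B) \<le> d M * ((\<Sum>n<M. s n) - B)" using S(1)[of M] nonneg by (intro mult_left_mono) auto
  ultimately show ?thesis by (simp add: abs_le_iff algebra_simps)
qed

lemma sum_split_lessThan:
  fixes f :: "nat \<Rightarrow> real"
  assumes "M \<le> N" shows "(\<Sum>n<N. f n) = (\<Sum>n<M. f n) + (\<Sum>n=M..<N. f n)"
  using sum.atLeastLessThan_concat[of 0 M N f] assms by (simp add: lessThan_atLeast0)

text \<open>The kernel with coefficients \<open>a\<close> is a combination of Dirichlet kernels with the increments of \<open>a\<close> as weights.
  By concavity these increments grow towards the end point \<open>N\<close>. Before an arbitrary cut \<open>M\<close> the oscillation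
  is exploited by summation by parts, which costs the last increment; after \<open>M\<close> the increments are
  simply added up, which gives \<open>a M\<close>. Concavity also bounds the increment at \<open>M\<close> by the mean slope \<open>a M / (N - M)\<close>.\<close>

lemma concave_weight_kernel_bound:
  fixes a :: "nat \<Rightarrow> real"
  assumes mono: "\<And>n. a (Suc n) \<le> a n"
    and concave: "\<And>n. Suc (Suc n) \<le> N \<Longrightarrow> a n - a (Suc n) \<le> a (Suc n) - a (Suc (Suc n))"
    and aN: "a N = 0" and M: "M < N" and \<theta>: "0 < sin (\<theta> / 2)"
  shows "\<bar>\<Sum>n<N. (a n - a (Suc n)) * dirichlet_kernel n \<theta>\<bar>
    \<le> a M / sin (\<theta> / 2) * (1 + 1 / (real (N - M) * sin (\<theta> / 2)))"
proof -
  define d where "d n = a n - a (Suc n)" for n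
  define s where "s n = sin ((real n + 1/2) * \<theta>)" for n
  define \<sigma> where "\<sigma> = sin (\<theta> / 2)"
  have \<sigma>: "\<sigma> > 0" using \<theta> by (simp add: \<sigma>_def)
  have d: "0 \<le> d n" for n using mono by (simp add: d_def)
  have dmono: "d n \<le> d (Suc n)" if "n < M" for n
    unfolding d_def using that M by (intro concave) auto
  have dM: "d M \<le> d n" if "M \<le> n" "n < N" for n
    using that
  proof (induction n rule: dec_induct)
    case (step n)
    then show ?case using concave[of n] unfolding d_def by simp
  qed simp
  have tail: "(\<Sum>n=M..<N. d n) = a M"
    using sum_Suc_diff'[of M N "\<lambda>n. - a n"] M aN by (simp add: d_def)
  have "real (N - M) * d M \<le> (\<Sum>n=M..<N. d n)"
    using sum_bounded_below[of "{M..<N}" "d M" d] dM by simp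
  then have "real (N - M) * d M \<le> a M" using tail by simp
  then have dM': "d M \<le> a M / real (N - M)" using M by (simp add: field_simps)
  have S: "\<sigma> * (\<Sum>n<k. s n) = (1 - cos (real k * \<theta>)) / 2" for k
    unfolding \<sigma>_def s_def by (rule sin_half_sum_sin)
  have S0: "0 \<le> (\<Sum>n<k. s n)" and S1: "(\<Sum>n<k. s n) \<le> 1 / \<sigma>" for k
  proof -
    have "0 \<le> \<sigma> * (\<Sum>n<k. s n)" unfolding S by simp
    then show "0 \<le> (\<Sum>n<k. s n)" using \<sigma> by (simp add: zero_le_mult_iff)
    have "\<sigma> * (\<Sum>n<k. s n) \<le> 1" unfolding S using cos_ge_minus_one[of "real k * \<theta>"] by simp
    then show "(\<Sum>n<k. s n) \<le> 1 / \<sigma>" using \<sigma> by (simp add: field_simps)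
  qed
  have head: "\<bar>\<Sum>n<M. d n * s n\<bar> \<le> 1 / \<sigma> * d M"
    using d dmono S0 S1 by (intro abel_sum_bound) auto
  have "\<bar>\<Sum>n=M..<N. d n * s n\<bar> \<le> (\<Sum>n=M..<N. d n)"
  proof (rule order_trans[OF sum_abs sum_mono])
    show "\<bar>d n * s n\<bar> \<le> d n" for n
      using mult_left_mono[of "\<bar>s n\<bar>" 1 "d n"] d[of n] by (simp add: abs_mult s_def)
  qed
  then have "\<bar>\<Sum>n<N. d n * s n\<bar> \<le> 1 / \<sigma> * d M + a M"
    using head tail sum_split_lessThan[of M N "\<lambda>n. d n * s n"] M by simp
  also have "\<dots> \<le> 1 / \<sigma> * (a M / real (N - M)) + a M"
    using dM' \<sigma> by (intro add_right_mono mult_left_mono) auto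
  also have "(\<Sum>n<N. d n * s n) = \<sigma> * (\<Sum>n<N. d n * dirichlet_kernel n \<theta>)"
    unfolding s_def \<sigma>_def sin_half_dirichlet_kernel[symmetric] by (simp add: sum_distrib_left mult_ac)
  also have "\<bar>\<dots>\<bar> = \<sigma> * \<bar>\<Sum>n<N. d n * dirichlet_kernel n \<theta>\<bar>" using \<sigma> by (simp add: abs_mult)
  finally have "\<bar>\<Sum>n<N. d n * dirichlet_kernel n \<theta>\<bar> \<le> (1 / \<sigma> * (a M / real (N - M)) + a M) / \<sigma>"
    using \<sigma> by (simp add: pos_le_divide_eq mult.commute)
  also have "\<dots> = a M / \<sigma> * (1 + 1 / (real (N - M) * \<sigma>))" using \<sigma> M by (simp add: field_simps)
  finally show ?thesis unfolding d_def \<sigma>_def .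
qed

text \<open>Bernoulli's inequality for exponents in the unit interval, as an instance of weighted
  arithmetic-geometric means.\<close>

lemma powr_le_affine:
  fixes u :: real
  assumes "0 \<le> u" "0 \<le> \<beta>" "\<beta> \<le> 1"
  shows "u powr \<beta> \<le> \<beta> * u + (1 - \<beta>)"
proof (cases "u = 0")
  case False
  then show ?thesis using Youngs_inequality_0[of \<beta> "1 - \<beta>" u 1] assms by simp
qed (use assms in auto)

lemma powr_midpoint_concave:
  fixes x y :: real
  assumes "0 \<le> x" "0 \<le> y" "0 \<le> \<beta>" "\<beta> \<le> 1"
  shows "x powr \<beta> + y powr \<beta> \<le> 2 * ((x + y) / 2) powr \<beta>"
proof (cases "x + y = 0")
  case True
  then have "x = 0" "y = 0" using assms by auto
  then show ?thesis by simp
next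
  case False
  define m where "m = (x + y) / 2"
  have m: "m > 0" using False assms by (simp add: m_def)
  have "u powr \<beta> \<le> m powr \<beta> * (\<beta> * (u / m) + (1 - \<beta>))" if "0 \<le> u" for u
  proof -
    have "u powr \<beta> = m powr \<beta> * (u / m) powr \<beta>"
      using m that by (simp add: powr_mult[symmetric])
    also have "\<dots> \<le> m powr \<beta> * (\<beta> * (u / m) + (1 - \<beta>))"
      using m that assms by (intro mult_left_mono powr_le_affine) auto
    finally show ?thesis .
  qed
  from add_mono[OF this[OF assms(1)] this[OF assms(2)]]
  have "x powr \<beta> + y powr \<beta> \<le> m powr \<beta> * (\<beta> * ((x + y) / m) + 2 * (1 - \<beta>))"
    by (simp add: algebra_simps add_divide_distrib)
  also have "(x + y) / m = 2" using m by (simp add: m_def field_simps)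
  finally show ?thesis by (simp add: m_def algebra_simps)
qed

lemma riesz_weight_end: "N \<ge> 1 \<Longrightarrow> riesz_weight \<beta> N N = 0"
  by (simp add: riesz_weight_def)

lemma riesz_base_nonneg: "n \<le> N \<Longrightarrow> 0 \<le> 1 - (real n)\<^sup>2 / (real N)\<^sup>2"
  by (cases "N = 0") (auto simp: field_simps intro!: power_mono)

lemma riesz_weight_nonneg: "0 \<le> riesz_weight \<beta> N n"
  by (simp add: riesz_weight_def)

lemma riesz_weight_mono:
  assumes "\<beta> > 0" shows "riesz_weight \<beta> N (Suc n) \<le> riesz_weight \<beta> N n"
proof (cases "Suc n \<le> N")
  case True
  then show ?thesis using assms riesz_base_nonneg[of "Suc n" N]
    by (auto simp: riesz_weight_def intro!: powr_mono2 diff_left_mono divide_right_mono power_mono)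
qed (simp add: riesz_weight_def)

text \<open>For an exponent at most one the weight is a concave increasing function of the concave function \<open>1 - n\<^sup>2 / N\<^sup>2\<close>.
  For larger exponents the weight is convex near \<open>n = N\<close>, and products of weights take over.\<close>

lemma riesz_weight_concave:
  assumes "0 < \<beta>" "\<beta> \<le> 1" "Suc (Suc n) \<le> N"
  shows "riesz_weight \<beta> N n - riesz_weight \<beta> N (Suc n) \<le> riesz_weight \<beta> N (Suc n) - riesz_weight \<beta> N (Suc (Suc n))"
proof -
  define b where "b n = 1 - (real n)\<^sup>2 / (real N)\<^sup>2" for n
  have b: "0 \<le> b k" if "k \<le> N" for k unfolding b_def using that by (rule riesz_base_nonneg)
  have sq: "(real n)\<^sup>2 + (real (Suc (Suc n)))\<^sup>2 = 2 * (real (Suc n))\<^sup>2 + 2"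
    by (simp add: power2_eq_square algebra_simps)
  have "b n + b (Suc (Suc n)) = 2 - ((real n)\<^sup>2 + (real (Suc (Suc n)))\<^sup>2) / (real N)\<^sup>2"
    unfolding b_def add_divide_distrib by (simp del: of_nat_Suc)
  also have "\<dots> = 2 * b (Suc n) - 2 / (real N)\<^sup>2"
    unfolding sq b_def add_divide_distrib by (simp del: of_nat_Suc)
  finally have "b n + b (Suc (Suc n)) = 2 * b (Suc n) - 2 / (real N)\<^sup>2" .
  then have le: "(b n + b (Suc (Suc n))) / 2 \<le> b (Suc n)" by simp
  have "b n powr \<beta> + b (Suc (Suc n)) powr \<beta> \<le> 2 * ((b n + b (Suc (Suc n))) / 2) powr \<beta>"
    using assms b by (intro powr_midpoint_concave) auto
  also have "\<dots> \<le> 2 * b (Suc n) powr \<beta>"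
    using le assms b[of n] b[of "Suc (Suc n)"] by (intro mult_left_mono powr_mono2) auto
  finally show ?thesis using assms by (simp add: riesz_weight_def b_def)
qed

definition riesz_kernel :: "real \<Rightarrow> nat \<Rightarrow> real \<Rightarrow> real" where
  "riesz_kernel \<beta> N \<theta> = (\<Sum>n<N. (riesz_weight \<beta> N n - riesz_weight \<beta> N (Suc n)) * dirichlet_kernel n \<theta>)"

lemma sin_ge_half:
  fixes x :: real
  assumes "0 \<le> x" "x \<le> pi / 2" shows "x / 2 \<le> sin x"
proof -
  have "\<bar>sin x - (\<Sum>m<3. sin_coeff m * x ^ m)\<bar> \<le> inverse (fact 3) * \<bar>x\<bar> ^ 3"
    by (rule Maclaurin_sin_bound)
  moreover have "(\<Sum>m<3. sin_coeff m * x ^ m) = x"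
    by (simp add: numeral_3_eq_3 sin_coeff_def)
  moreover have "inverse (fact 3) * \<bar>x\<bar> ^ 3 = x * x\<^sup>2 / 6"
    using assms by (simp add: fact_numeral power3_eq_cube power2_eq_square)
  moreover have "x * x\<^sup>2 / 6 \<le> x * 3 / 6"
  proof -
    have "x\<^sup>2 \<le> (16/10)\<^sup>2" using assms pi_approx by (intro power_mono) auto
    then show ?thesis using assms by (intro divide_right_mono mult_left_mono) (auto simp: power2_eq_square)
  qed
  ultimately show ?thesis by linarith
qed

text \<open>The kernel is of height \<open>N\<close>, of width \<open>1 / N\<close>, and decays integrably beyond that width. The decay comes from
  \<open>concave_weight_kernel_bound\<close> with a cut at distance about \<open>1 / |\<theta>|\<close> from the end point, where
  the weight is of size \<open>(1 / (N |\<theta>|)) powr \<beta>\<close>. The constant is \<open>4 * 10 * 5 * 4\<close>: the sine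
  from below, the weight at the cut, the two parts of the sum, and the passage from \<open>N |\<theta>|\<close> to \<open>1 + N |\<theta>|\<close>.\<close>

lemma riesz_kernel_bound:
  assumes \<beta>: "0 < \<beta>" "\<beta> \<le> 1" and N: "N \<ge> 1" and \<theta>: "\<bar>\<theta>\<bar> \<le> pi"
  shows "\<bar>riesz_kernel \<beta> N \<theta>\<bar> \<le> 800 * real N * (1 + real N * \<bar>\<theta>\<bar>) powr (- 1 - \<beta>)"
proof -
  define \<phi> where "\<phi> = real N * \<bar>\<theta>\<bar>"
  have \<phi>: "0 \<le> \<phi>" by (simp add: \<phi>_def)
  show ?thesis
  proof (cases "\<phi> < 1")
    case True
    have "\<bar>riesz_kernel \<beta> N \<theta>\<bar>
        \<le> (\<Sum>n<N. (riesz_weight \<beta> N n - riesz_weight \<beta> N (Suc n)) * (3 * real N))"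
      unfolding riesz_kernel_def
    proof (rule order_trans[OF sum_abs sum_mono])
      fix n assume "n \<in> {..<N}"
      then have "\<bar>dirichlet_kernel n \<theta>\<bar> \<le> 3 * real N" using dirichlet_kernel_bound[of n \<theta>] by simp
      then show "\<bar>(riesz_weight \<beta> N n - riesz_weight \<beta> N (Suc n)) * dirichlet_kernel n \<theta>\<bar>
          \<le> (riesz_weight \<beta> N n - riesz_weight \<beta> N (Suc n)) * (3 * real N)"
        unfolding abs_mult using riesz_weight_mono[OF \<beta>(1), of N n] by (simp add: mult_left_mono)
    qed
    also have "\<dots> = 3 * real N"
      unfolding sum_distrib_right[symmetric] sum_lessThan_telescope'
      using N by (simp add: riesz_weight_end) (simp add: riesz_weight_def)
    also have "\<dots> \<le> 800 * real N * (1/4)" by simp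
    also have "1/4 = (2::real) powr (- 2)" by (simp add: powr_minus_divide)
    also have "(2::real) powr (- 2) \<le> 2 powr (- 1 - \<beta>)" using \<beta> by simp
    also have "\<dots> \<le> (1 + \<phi>) powr (- 1 - \<beta>)" using True \<phi> \<beta> by (intro powr_mono2') auto
    finally show ?thesis by (simp add: \<phi>_def mult_left_mono)
  next
    case False
    define t where "t = \<bar>\<theta>\<bar>"
    have t: "0 < t" "t \<le> pi" and Nt: "1 \<le> real N * t"
      using False \<theta> by (auto simp: t_def \<phi>_def intro: ccontr)
    \<comment> \<open>\<open>q\<close> is the distance of the cut from the end point\<close>
    define q where "q = nat \<lceil>1 / t\<rceil>"
    have q1: "1 / t \<le> real q" using t unfolding q_def by simp
    have q0: "0 < q" using t unfolding q_def by simp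
    have "1 / t \<le> real N" using t Nt by (simp add: field_simps)
    then have qN: "q \<le> N" unfolding q_def using ceiling_mono[of "1/t" "real N"] by simp
    have "real q \<le> 1 / t + 1" using t unfolding q_def by (simp add: of_nat_ceiling)
    also have "\<dots> \<le> 5 / t" using t pi_less_4 by (simp add: field_simps)
    finally have q2: "real q \<le> 5 / t" .
    have \<sigma>: "t / 4 \<le> sin (t / 2)" using sin_ge_half[of "t/2"] t by simp
    then have \<sigma>0: "0 < sin (t / 2)" using t by linarith
    have "\<bar>riesz_kernel \<beta> N \<theta>\<bar> = \<bar>\<Sum>n<N. (riesz_weight \<beta> N n - riesz_weight \<beta> N (Suc n)) * dirichlet_kernel n t\<bar>"
      unfolding riesz_kernel_def t_def dirichlet_kernel_abs ..
    also have "\<dots> \<le> riesz_weight \<beta> N (N - q) / sin (t / 2) * (1 + 1 / (real (N - (N - q)) * sin (t / 2)))"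
      using riesz_weight_mono[OF \<beta>(1)] riesz_weight_concave[OF \<beta>] riesz_weight_end[OF N] q0 qN \<sigma>0
      by (intro concave_weight_kernel_bound) auto
    also have "\<dots> = riesz_weight \<beta> N (N - q) * (1 / sin (t / 2)) * (1 + (1 / real q) * (1 / sin (t / 2)))"
      using qN by simp
    also have "\<dots> \<le> (10 * \<phi> powr (- \<beta>)) * (4 / t) * (1 + t * (4 / t))"
    proof (intro mult_mono add_mono)
      show i: "1 / sin (t / 2) \<le> 4 / t" "1 / sin (t / 2) \<le> 4 / t" using \<sigma> \<sigma>0 t by (auto simp: field_simps)
      show "1 / real q \<le> t" using q1 q0 t by (simp add: field_simps)
      have "1 - (real (N - q))\<^sup>2 / (real N)\<^sup>2 \<le> 10 / \<phi>"
      proof -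
        have "1 - (real (N - q))\<^sup>2 / (real N)\<^sup>2 = 2 * (real q / real N) - (real q / real N)\<^sup>2"
          using N qN by (simp add: of_nat_diff field_simps power2_eq_square)
        also have "\<dots> \<le> 2 * (real q / real N)" by simp
        also have "\<dots> \<le> 2 * ((5 / t) / real N)" using q2 by (intro mult_left_mono divide_right_mono) auto
        also have "\<dots> = 10 / \<phi>" by (simp add: \<phi>_def t_def)
        finally show ?thesis .
      qed
      then have "riesz_weight \<beta> N (N - q) \<le> (10 / \<phi>) powr \<beta>"
        unfolding riesz_weight_def using \<beta> riesz_base_nonneg[of "N - q" N] by (auto intro!: powr_mono2)
      also have "\<dots> = 10 powr \<beta> * \<phi> powr (- \<beta>)" using \<phi> by (simp add: powr_divide powr_minus_divide)
      also have "\<dots> \<le> 10 powr 1 * \<phi> powr (- \<beta>)" using \<beta> by (intro mult_right_mono powr_mono) auto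
      finally show "riesz_weight \<beta> N (N - q) \<le> 10 * \<phi> powr (- \<beta>)" by simp
    qed (use t \<sigma>0 riesz_weight_nonneg in auto)
    also have "\<dots> = 200 * \<phi> powr (- \<beta>) / t" using t by simp
    also have "\<dots> = 200 * real N * \<phi> powr (- 1 - \<beta>)"
    proof -
      have "\<phi> powr (- 1 - \<beta>) = \<phi> powr (- \<beta>) / \<phi>"
        using False by (simp add: powr_diff powr_minus field_simps)
      then show ?thesis using N by (simp add: \<phi>_def t_def)
    qed
    also have "\<dots> \<le> 200 * real N * (4 * (1 + \<phi>) powr (- 1 - \<beta>))"
    proof (intro mult_left_mono)
      have "\<phi> powr (- 1 - \<beta>) \<le> ((1 + \<phi>) / 2) powr (- 1 - \<beta>)"
        using False \<beta> by (intro powr_mono2') auto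
      also have "\<dots> = (1 + \<phi>) powr (- 1 - \<beta>) * 2 powr (1 + \<beta>)"
        using \<phi> by (simp add: powr_divide powr_minus_divide field_simps powr_diff powr_add)
      also have "\<dots> \<le> (1 + \<phi>) powr (- 1 - \<beta>) * 2 powr 2"
        using \<beta> by (intro mult_left_mono powr_mono) auto
      finally show "\<phi> powr (- 1 - \<beta>) \<le> 4 * (1 + \<phi>) powr (- 1 - \<beta>)" by simp
    qed simp
    finally show ?thesis by (simp add: \<phi>_def)
  qed
qed

definition circle :: "real measure" where
  "circle = restrict_space lborel {-pi..pi}"

lemma circle_finite: "finite_measure circle"
  unfolding circle_def by (rule finite_measureI) (simp add: emeasure_restrict_space space_restrict_space)

lemma space_circle: "space circle = {-pi..pi}"
  by (simp add: circle_def space_restrict_space)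

lemma circle_measurable: "f \<in> borel_measurable borel \<Longrightarrow> f \<in> borel_measurable circle"
  unfolding circle_def by (rule measurable_restrict_space1) simp

lemma circle_integrable:
  fixes f :: "real \<Rightarrow> 'a :: {banach, second_countable_topology}"
  assumes "continuous_on UNIV f" shows "integrable circle f"
  unfolding circle_def
  using borel_integrable_atLeastAtMost'[of "-pi" pi f] continuous_on_subset[OF assms]
  by (simp add: integrable_restrict_space set_integrable_def)

lemma integral_circle_cis:
  "(\<integral>\<theta>. cis (of_int l * \<theta>) \<partial>circle) = (if l = 0 then 2 * of_real pi else 0)"
proof (cases "l = 0")
  case True
  then show ?thesis by (simp add: circle_def measure_restrict_space space_restrict_space scaleR_conv_of_real)
next
  case False
  have "(LBINT \<theta>. indicator {-pi..pi} \<theta> *\<^sub>R cis (of_int l * \<theta>))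
      = cis (of_int l * pi) / (\<i> * of_int l) - cis (of_int l * (- pi)) / (\<i> * of_int l)"
  proof (rule integral_FTC_Icc)
    show "((\<lambda>\<theta>. cis (of_int l * \<theta>) / (\<i> * of_int l)) has_vector_derivative cis (of_int l * x)) (at x within {-pi..pi})" for x
    proof -
      have "((\<lambda>w. exp (\<i> * (of_int l * w))) has_field_derivative exp (\<i> * (of_int l * of_real x)) * (\<i> * of_int l)) (at (of_real x))"
        by (auto intro!: derivative_eq_intros)
      from DERIV_cdivide[OF this, of "\<i> * of_int l"]
      have "((\<lambda>w. exp (\<i> * (of_int l * w)) / (\<i> * of_int l)) has_field_derivative exp (\<i> * (of_int l * of_real x))) (at (of_real x))"
        using False by simp
      from has_vector_derivative_real_field[OF this] show ?thesis
        by (simp add: cis_conv_exp)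
    qed
    show "continuous_on {-pi..pi} (\<lambda>\<theta>. cis (of_int l * \<theta>))" by (intro continuous_intros)
  qed simp
  also have "\<dots> = 0" by (simp add: cis.ctr sin_int_times_real complex_eq_iff mult.commute[of _ pi] diff_divide_distrib[symmetric])
  finally show ?thesis using False by (simp add: circle_def integral_restrict_space)
qed

lemma integral_dirichlet_kernel_cis:
  "(\<integral>\<theta>. of_real (dirichlet_kernel n \<theta>) * cis (- (real m * \<theta>)) \<partial>circle)
    = (if m \<le> n then 2 * of_real pi else 0)"
proof (induction n)
  case 0
  show ?case using integral_circle_cis[of "- int m"] by (simp add: dirichlet_kernel_def)
next
  case (Suc n)
  have c: "continuous_on UNIV (\<lambda>\<theta>. cis (of_int l * \<theta>))" for l by (intro continuous_intros)
  have cd: "continuous_on UNIV (\<lambda>\<theta>. complex_of_real (dirichlet_kernel n \<theta>) * cis (- (real m * \<theta>)))"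
    unfolding dirichlet_kernel_def by (intro continuous_intros)
  have "of_real (dirichlet_kernel (Suc n) \<theta>) * cis (- (real m * \<theta>))
     = of_real (dirichlet_kernel n \<theta>) * cis (- (real m * \<theta>))
       + (cis (of_int (int (Suc n) - int m) * \<theta>) + cis (of_int (- int (Suc n) - int m) * \<theta>))" for \<theta>
  proof -
    have "complex_of_real (dirichlet_kernel (Suc n) \<theta>) = of_real (dirichlet_kernel n \<theta>)
        + (cis (real (Suc n) * \<theta>) + cis (- (real (Suc n) * \<theta>)))"
      by (simp add: dirichlet_kernel_def complex_eq_iff)
    then show ?thesis by (simp add: distrib_right cis_mult algebra_simps)
  qed
  then have "(\<integral>\<theta>. of_real (dirichlet_kernel (Suc n) \<theta>) * cis (- (real m * \<theta>)) \<partial>circle)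
     = (if m \<le> n then 2 * of_real pi else 0) + ((if int (Suc n) - int m = 0 then 2 * of_real pi else 0)
        + (if - int (Suc n) - int m = 0 then 2 * of_real pi else 0))"
    by (simp only: Bochner_Integration.integral_add circle_integrable c cd Bochner_Integration.integrable_add integral_circle_cis Suc)
  then show ?case by auto
qed

lemma riesz_kernel_continuous: "continuous_on A (riesz_kernel \<beta> N)"
  unfolding riesz_kernel_def dirichlet_kernel_def by (intro continuous_intros)

text \<open>The increments of the weight telescope from \<open>m\<close> to \<open>N\<close>, where the weight vanishes.\<close>

lemma integral_riesz_kernel_cis:
  assumes "N \<ge> 1"
  shows "(\<integral>\<theta>. of_real (riesz_kernel \<beta> N \<theta>) * cis (- (real m * \<theta>)) \<partial>circle)
    = 2 * of_real pi * of_real (riesz_weight \<beta> N m)"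
proof -
  define d where "d n = riesz_weight \<beta> N n - riesz_weight \<beta> N (Suc n)" for n
  have int: "integrable circle (\<lambda>\<theta>. complex_of_real (dirichlet_kernel n \<theta>) * cis (- (real m * \<theta>)))" for n
    unfolding dirichlet_kernel_def by (intro circle_integrable continuous_intros)
  have "(\<integral>\<theta>. of_real (riesz_kernel \<beta> N \<theta>) * cis (- (real m * \<theta>)) \<partial>circle)
     = (\<integral>\<theta>. (\<Sum>n<N. of_real (d n) * (of_real (dirichlet_kernel n \<theta>) * cis (- (real m * \<theta>)))) \<partial>circle)"
    by (simp add: riesz_kernel_def d_def sum_distrib_right mult.assoc)
  also have "\<dots> = (\<Sum>n<N. of_real (d n) * (if m \<le> n then 2 * of_real pi else 0))"
    by (subst Bochner_Integration.integral_sum) (auto intro!: int integrable_mult_right simp: integral_dirichlet_kernel_cis)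
  also have "\<dots> = (\<Sum>n\<in>{m..<N}. of_real (d n) * (2 * of_real pi))"
    by (rule sum.mono_neutral_cong_right) auto
  also have "\<dots> = 2 * of_real pi * of_real (\<Sum>n\<in>{m..<N}. d n)"
    by (simp add: sum_distrib_left mult.commute)
  also have "(\<Sum>n\<in>{m..<N}. d n) = riesz_weight \<beta> N m"
  proof (cases "m \<le> N")
    case True
    then show ?thesis using sum_Suc_diff'[of m N "\<lambda>n. - riesz_weight \<beta> N n"] riesz_weight_end[OF assms]
      by (simp add: d_def)
  qed (simp add: riesz_weight_def)
  finally show ?thesis .
qed

section \<open>Rotations of the phase plane\<close>

definition rot :: "real \<Rightarrow> real \<times> real \<Rightarrow> real \<times> real" where
  "rot \<theta> z = (fst z * cos \<theta> - snd z * sin \<theta>, fst z * sin \<theta> + snd z * cos \<theta>)"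

lemma fock_point_rot: "fock_point (rot \<theta> z) = cis (- \<theta>) * fock_point z"
  by (simp add: fock_point_def rot_def complex_eq_iff algebra_simps diff_divide_distrib add_divide_distrib)

lemma fock_weight_rot: "fock_weight (rot \<theta> z) = fock_weight z"
proof -
  have "(fst (rot \<theta> z))\<^sup>2 + (snd (rot \<theta> z))\<^sup>2 = ((fst z)\<^sup>2 + (snd z)\<^sup>2) * ((sin \<theta>)\<^sup>2 + (cos \<theta>)\<^sup>2)"
    unfolding rot_def fst_conv snd_conv by algebra
  then show ?thesis by (simp add: fock_weight_def)
qed

lemma continuous_rot: "continuous_on UNIV (\<lambda>x. rot (fst x) (snd x))"
  unfolding rot_def by (intro continuous_intros)

lemma nn_integral_shear_fst:
  fixes g :: "real \<times> real \<Rightarrow> ennreal"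
  assumes [measurable]: "g \<in> borel_measurable borel"
  shows "(\<integral>\<^sup>+z. g (fst z + a * snd z, snd z) \<partial>lborel) = (\<integral>\<^sup>+z. g z \<partial>lborel)"
proof -
  have [measurable]: "g \<in> borel_measurable (borel \<Otimes>\<^sub>M borel)" by (simp add: borel_prod)
  have "(\<integral>\<^sup>+x. g (x + a * y, y) \<partial>lborel) = (\<integral>\<^sup>+x. g (x, y) \<partial>lborel)" for y
    using nn_integral_real_affine[of "\<lambda>x. g (x, y)" 1 "a * y"] by (simp add: add.commute)
  then have "(\<integral>\<^sup>+y. \<integral>\<^sup>+x. g (fst (x, y) + a * snd (x, y), snd (x, y)) \<partial>lborel \<partial>lborel) = (\<integral>\<^sup>+y. \<integral>\<^sup>+x. g (x, y) \<partial>lborel \<partial>lborel)"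
    by simp
  then show ?thesis
    by (subst (asm) lborel_pair.nn_integral_snd, measurable) (subst (asm) lborel_pair.nn_integral_snd, measurable, simp add: lborel_prod)
qed

lemma nn_integral_shear_snd:
  fixes g :: "real \<times> real \<Rightarrow> ennreal"
  assumes [measurable]: "g \<in> borel_measurable borel"
  shows "(\<integral>\<^sup>+z. g (fst z, snd z + a * fst z) \<partial>lborel) = (\<integral>\<^sup>+z. g z \<partial>lborel)"
proof -
  have [measurable]: "g \<in> borel_measurable (borel \<Otimes>\<^sub>M borel)" by (simp add: borel_prod)
  have "(\<integral>\<^sup>+y. g (x, y + a * x) \<partial>lborel) = (\<integral>\<^sup>+y. g (x, y) \<partial>lborel)" for x
    using nn_integral_real_affine[of "\<lambda>y. g (x, y)" 1 "a * x"] by (simp add: add.commute)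
  then have "(\<integral>\<^sup>+x. \<integral>\<^sup>+y. g (fst (x, y), snd (x, y) + a * fst (x, y)) \<partial>lborel \<partial>lborel) = (\<integral>\<^sup>+x. \<integral>\<^sup>+y. g (x, y) \<partial>lborel \<partial>lborel)"
    by simp
  then show ?thesis
    by (subst (asm) lborel.nn_integral_fst, measurable) (subst (asm) lborel.nn_integral_fst, measurable, simp add: lborel_prod)
qed

lemma rot_measurable [measurable]: "rot \<theta> \<in> borel_measurable borel"
  by (rule borel_measurable_continuous_onI) (unfold rot_def[abs_def], intro continuous_intros)

text \<open>A rotation is a product of three shears, and a shear preserves Lebesgue measure by Fubini and
  translation invariance on each line.\<close>

lemma nn_integral_rot_shears:
  fixes g :: "real \<times> real \<Rightarrow> ennreal"
  assumes g: "g \<in> borel_measurable borel" and c: "cos (\<theta> / 2) \<noteq> 0"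
  shows "(\<integral>\<^sup>+z. g (rot \<theta> z) \<partial>lborel) = (\<integral>\<^sup>+z. g z \<partial>lborel)"
proof -
  define t where "t = tan (\<theta> / 2)"
  define sh1 :: "real \<Rightarrow> real \<times> real \<Rightarrow> real \<times> real" where "sh1 a z = (fst z + a * snd z, snd z)" for a z
  define sh2 :: "real \<Rightarrow> real \<times> real \<Rightarrow> real \<times> real" where "sh2 a z = (fst z, snd z + a * fst z)" for a z
  have m1: "sh1 a \<in> borel_measurable borel" and m2: "sh2 a \<in> borel_measurable borel" for a
    unfolding sh1_def[abs_def] sh2_def[abs_def]
    by (intro borel_measurable_continuous_onI continuous_intros)+
  have i1: "(\<integral>\<^sup>+z. h (sh1 a z) \<partial>lborel) = (\<integral>\<^sup>+z. h z \<partial>lborel)"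
    and i2: "(\<integral>\<^sup>+z. h (sh2 a z) \<partial>lborel) = (\<integral>\<^sup>+z. h z \<partial>lborel)"
    if "h \<in> borel_measurable borel" for h :: "real \<times> real \<Rightarrow> ennreal" and a
    unfolding sh1_def sh2_def using nn_integral_shear_fst[OF that] nn_integral_shear_snd[OF that] by auto
  have s: "sin \<theta> = 2 * sin (\<theta> / 2) * cos (\<theta> / 2)" and cc: "cos \<theta> = 1 - 2 * (sin (\<theta> / 2))\<^sup>2"
    using sin_double[of "\<theta> / 2"] cos_double_sin[of "\<theta> / 2"] by simp_all
  \<comment> \<open>half-angle identities: the parameters of the three shears are \<open>- tan (\<theta> / 2)\<close>, \<open>sin \<theta>\<close>, \<open>- tan (\<theta> / 2)\<close>\<close>
  have ts: "t * sin \<theta> = 1 - cos \<theta>"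
    using c unfolding t_def s cc tan_def by (simp add: power2_eq_square)
  have tc: "t * (1 + cos \<theta>) = sin \<theta>"
  proof -
    have "1 + cos \<theta> = 2 * (cos (\<theta> / 2))\<^sup>2" unfolding cc cos_squared_eq by simp
    then show ?thesis using c unfolding t_def s tan_def by (simp add: power2_eq_square)
  qed
  have "rot \<theta> z = sh1 (- t) (sh2 (sin \<theta>) (sh1 (- t) z))" for z
  proof -
    have "snd (sh2 (sin \<theta>) (sh1 (- t) z)) = fst z * sin \<theta> + snd z * (1 - t * sin \<theta>)"
      by (simp add: sh1_def sh2_def algebra_simps)
    then have sn: "snd (sh2 (sin \<theta>) (sh1 (- t) z)) = fst z * sin \<theta> + snd z * cos \<theta>"
      by (simp add: ts)
    have "fst (sh1 (- t) (sh2 (sin \<theta>) (sh1 (- t) z))) = fst z - t * snd z - t * (fst z * sin \<theta> + snd z * cos \<theta>)"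
      using sn by (simp add: sh1_def sh2_def)
    also have "\<dots> = fst z * (1 - t * sin \<theta>) - snd z * (t * (1 + cos \<theta>))" by (simp add: algebra_simps)
    also have "\<dots> = fst z * cos \<theta> - snd z * sin \<theta>" by (simp add: ts tc)
    finally show ?thesis using sn by (simp add: rot_def sh1_def[of _ "sh2 _ _"])
  qed
  then have "(\<integral>\<^sup>+z. g (rot \<theta> z) \<partial>lborel) = (\<integral>\<^sup>+z. g (sh1 (- t) (sh2 (sin \<theta>) (sh1 (- t) z))) \<partial>lborel)"
    by simp
  also have "\<dots> = (\<integral>\<^sup>+z. g (sh1 (- t) (sh2 (sin \<theta>) z)) \<partial>lborel)"
    by (rule i1[OF measurable_compose[OF m2 measurable_compose[OF m1 g]]])
  also have "\<dots> = (\<integral>\<^sup>+z. g (sh1 (- t) z) \<partial>lborel)"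
    by (rule i2[OF measurable_compose[OF m1 g]])
  also have "\<dots> = (\<integral>\<^sup>+z. g z \<partial>lborel)"
    by (rule i1[OF g])
  finally show ?thesis .
qed

lemma rot_rot: "rot \<theta> (rot \<phi> z) = rot (\<theta> + \<phi>) z"
  by (simp add: rot_def cos_add sin_add algebra_simps)

text \<open>The half turn has no decomposition into such shears, so each rotation is performed as two rotations by half the angle.\<close>

lemma nn_integral_rot:
  fixes g :: "real \<times> real \<Rightarrow> ennreal"
  assumes g: "g \<in> borel_measurable borel" and \<theta>: "\<bar>\<theta>\<bar> \<le> pi"
  shows "(\<integral>\<^sup>+z. g (rot \<theta> z) \<partial>lborel) = (\<integral>\<^sup>+z. g z \<partial>lborel)"
proof -
  have "0 < cos (\<theta> / 2 / 2)" using \<theta> pi_gt_zero by (intro cos_gt_zero_pi) linarith+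
  then have c: "cos (\<theta> / 2 / 2) \<noteq> 0" by simp
  have "(\<integral>\<^sup>+z. g (rot (\<theta> / 2) (rot (\<theta> / 2) z)) \<partial>lborel) = (\<integral>\<^sup>+z. g (rot (\<theta> / 2) z) \<partial>lborel)"
    using nn_integral_rot_shears[OF measurable_compose[OF rot_measurable g] c] by simp
  also have "\<dots> = (\<integral>\<^sup>+z. g z \<partial>lborel)" by (rule nn_integral_rot_shears[OF g c])
  finally show ?thesis by (simp add: rot_rot)
qed

section \<open>Energies and averages over rotations\<close>

text \<open>The \<open>p\<close>-th power of the \<open>L\<^sup>p\<close> norm; staying with powers avoids roots of extended reals.\<close>

definition energy :: "real \<Rightarrow> (real \<times> real \<Rightarrow> complex) \<Rightarrow> ennreal" where
  "energy p u = (\<integral>\<^sup>+z. ennreal (norm (u z) powr p) \<partial>lborel)"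

lemma norm_add_powr_le:
  fixes a b :: "'a :: real_normed_vector"
  assumes "0 \<le> p"
  shows "norm (a + b) powr p \<le> 2 powr p * (norm a powr p + norm b powr p)"
proof -
  define m where "m = max (norm a) (norm b)"
  have "norm (a + b) powr p \<le> (2 * m) powr p"
    using norm_triangle_ineq[of a b] assms by (intro powr_mono2) (auto simp: m_def)
  also have "\<dots> = 2 powr p * m powr p" by (simp add: powr_mult m_def)
  also have "\<dots> \<le> 2 powr p * (norm a powr p + norm b powr p)"
    by (intro mult_left_mono) (auto simp: m_def max_def)
  finally show ?thesis .
qed

lemma energy_add_le:
  assumes "0 \<le> p" and [measurable]: "u \<in> borel_measurable borel" "v \<in> borel_measurable borel"
  shows "energy p (\<lambda>z. u z + v z) \<le> ennreal (2 powr p) * (energy p u + energy p v)"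
proof -
  have "energy p (\<lambda>z. u z + v z)
      \<le> (\<integral>\<^sup>+z. ennreal (2 powr p) * (ennreal (norm (u z) powr p) + ennreal (norm (v z) powr p)) \<partial>lborel)"
    unfolding energy_def using norm_add_powr_le[OF assms(1)]
    by (intro nn_integral_mono) (simp add: ennreal_mult[symmetric] ennreal_plus[symmetric] del: ennreal_plus)
  also have "\<dots> = ennreal (2 powr p) * (energy p u + energy p v)"
    unfolding energy_def by (simp add: nn_integral_cmult nn_integral_add)
  finally show ?thesis .
qed

lemma energy_rot:
  assumes "u \<in> borel_measurable borel" "\<bar>\<theta>\<bar> \<le> pi"
  shows "energy p (\<lambda>z. u (rot \<theta> z)) = energy p u"
proof -
  note [measurable] = assms(1)
  have "(\<lambda>z. ennreal (norm (u z) powr p)) \<in> borel_measurable borel" by measurable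
  from nn_integral_rot[OF this assms(2)] show ?thesis by (simp add: energy_def)
qed

text \<open>Rotation acts continuously in \<open>L\<^sup>p\<close>. By continuity of \<open>u\<close> there is pointwise convergence, and by rotation
  invariance the norms do not change at all, so Riesz's theorem applies. It is derived from Scheffe's
  lemma, applied to the \<open>p\<close>-th powers of the rotated functions and to the nonnegative functions
  \<open>F m = 2 powr p * (a m + b) - d m\<close>, where \<open>d m\<close> is the \<open>p\<close>-th power of the difference.\<close>

lemma energy_rot_diff_tendsto:
  assumes p: "p > 0" and u: "continuous_on UNIV u" and fin: "energy p u < \<infinity>"
    and \<theta>: "\<theta> \<longlonglongrightarrow> 0" "\<And>m. \<bar>\<theta> m\<bar> \<le> pi"
  shows "(\<lambda>m. energy p (\<lambda>z. u (rot (\<theta> m) z) - u z)) \<longlonglongrightarrow> 0"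
proof -
  have um [measurable]: "u \<in> borel_measurable borel" using u by (rule borel_measurable_continuous_onI)
  define a where "a m z = norm (u (rot (\<theta> m) z)) powr p" for m z
  define b where "b z = norm (u z) powr p" for z
  define d where "d m z = norm (u (rot (\<theta> m) z) - u z) powr p" for m z
  define F where "F m z = 2 powr p * (a m z + b z) - d m z" for m z
  have [measurable]: "a m \<in> borel_measurable lborel" "d m \<in> borel_measurable lborel" "b \<in> borel_measurable lborel" for m
    unfolding a_def b_def d_def by measurable
  have F0: "0 \<le> F m z" for m z
    using norm_add_powr_le[of p "u (rot (\<theta> m) z)" "- u z"] p unfolding F_def a_def b_def d_def by simp
  have Fm: "F m \<in> borel_measurable lborel" for m unfolding F_def by measurable
  have b0: "0 \<le> b z" and a0: "0 \<le> a m z" and d0: "0 \<le> d m z" for z m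
    by (simp_all add: a_def b_def d_def)
  have lim: "(\<lambda>m. u (rot (\<theta> m) z)) \<longlonglongrightarrow> u z" for z
  proof -
    have "continuous_on UNIV (\<lambda>t. u (rot t z))"
      by (rule continuous_on_compose2[OF u]) (auto simp: rot_def intro!: continuous_intros)
    then have "isCont (\<lambda>t. u (rot t z)) 0" by (simp add: continuous_on_eq_continuous_at)
    from isCont_tendsto_compose[OF this \<theta>(1)] show ?thesis by (simp add: rot_def)
  qed
  have a_lim: "(\<lambda>m. a m z) \<longlonglongrightarrow> b z" and d_lim: "(\<lambda>m. d m z) \<longlonglongrightarrow> 0" for z
  proof -
    show "(\<lambda>m. a m z) \<longlonglongrightarrow> b z"
      unfolding a_def b_def using p by (intro tendsto_powr' tendsto_norm lim) auto
    have "(\<lambda>m. norm (u (rot (\<theta> m) z) - u z)) \<longlonglongrightarrow> 0"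
      using lim by (intro tendsto_norm_zero LIM_zero)
    from tendsto_powr'[OF this tendsto_const[of p]] show "(\<lambda>m. d m z) \<longlonglongrightarrow> 0"
      unfolding d_def using p by simp
  qed
  have E: "(\<integral>\<^sup>+z. ennreal (b z) \<partial>lborel) = energy p u" by (simp add: energy_def b_def)
  have A: "(\<integral>\<^sup>+z. ennreal (a m z) \<partial>lborel) = energy p u" for m
    using energy_rot[OF um \<theta>(2), of p m] by (simp add: energy_def a_def)
  have bint: "integrable lborel b"
    using fin E b0 by (intro integrableI_nonneg) auto
  have 1: "(\<lambda>m. \<integral>\<^sup>+z. norm (a m z - b z) \<partial>lborel) \<longlonglongrightarrow> 0"
    by (rule Scheffe_lemma2) (use bint a_lim a0 b0 A E in auto)
  have 2: "(\<lambda>m. \<integral>\<^sup>+z. norm (F m z - 2 powr p * (b z + b z)) \<partial>lborel) \<longlonglongrightarrow> 0"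
  proof (rule Scheffe_lemma2[OF Fm])
    show "integrable lborel (\<lambda>z. 2 powr p * (b z + b z))" using bint by simp
    have "(\<lambda>m. F m z) \<longlonglongrightarrow> 2 powr p * (b z + b z) - 0" for z
      unfolding F_def by (intro tendsto_intros a_lim d_lim)
    then show "AE z in lborel. (\<lambda>m. F m z) \<longlonglongrightarrow> 2 powr p * (b z + b z)" by simp
    fix m
    have "(\<integral>\<^sup>+z. norm (F m z) \<partial>lborel) \<le> (\<integral>\<^sup>+z. ennreal (2 powr p) * (ennreal (a m z) + ennreal (b z)) \<partial>lborel)"
      using F0 a0 b0 d0 by (intro nn_integral_mono)
        (simp add: F_def ennreal_mult[symmetric] ennreal_plus[symmetric] ennreal_leI del: ennreal_plus)
    also have "\<dots> = ennreal (2 powr p) * (energy p u + energy p u)"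
      by (simp add: nn_integral_cmult nn_integral_add A E)
    also have "\<dots> = (\<integral>\<^sup>+z. ennreal (2 powr p) * (ennreal (b z) + ennreal (b z)) \<partial>lborel)"
      by (simp add: nn_integral_cmult nn_integral_add E)
    also have "\<dots> = (\<integral>\<^sup>+z. norm (2 powr p * (b z + b z)) \<partial>lborel)"
      using b0 by (simp add: ennreal_mult[symmetric] ennreal_plus[symmetric] del: ennreal_plus)
    finally show "(\<integral>\<^sup>+z. norm (F m z) \<partial>lborel) \<le> (\<integral>\<^sup>+z. norm (2 powr p * (b z + b z)) \<partial>lborel)" .
  qed
  define R where "R m = (\<integral>\<^sup>+z. norm (F m z - 2 powr p * (b z + b z)) \<partial>lborel)
      + ennreal (2 powr p) * (\<integral>\<^sup>+z. norm (a m z - b z) \<partial>lborel)" for m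
  have le: "energy p (\<lambda>z. u (rot (\<theta> m) z) - u z) \<le> R m" for m
  proof -
    have "energy p (\<lambda>z. u (rot (\<theta> m) z) - u z) \<le> (\<integral>\<^sup>+z. ennreal (norm (F m z - 2 powr p * (b z + b z)))
        + ennreal (2 powr p) * ennreal (norm (a m z - b z)) \<partial>lborel)"
      unfolding energy_def d_def[symmetric]
    proof (rule nn_integral_mono)
      fix z
      have "2 powr p * (a m z - b z) \<le> 2 powr p * \<bar>a m z - b z\<bar>" by (intro mult_left_mono) auto
      then have "d m z \<le> norm (F m z - 2 powr p * (b z + b z)) + 2 powr p * norm (a m z - b z)"
        by (simp add: F_def algebra_simps)
      then show "ennreal (d m z) \<le> ennreal (norm (F m z - 2 powr p * (b z + b z)))
        + ennreal (2 powr p) * ennreal (norm (a m z - b z))"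
        by (simp add: ennreal_mult[symmetric] ennreal_plus[symmetric] ennreal_leI del: ennreal_plus)
    qed
    also have "\<dots> = R m" unfolding R_def using Fm by (simp add: nn_integral_cmult nn_integral_add)
    finally show ?thesis .
  qed
  have "R \<longlonglongrightarrow> 0 + ennreal (2 powr p) * 0"
    unfolding R_def by (intro tendsto_add 2 ennreal_tendsto_cmult 1) auto
  then have R: "R \<longlonglongrightarrow> 0" by simp
  show ?thesis
    by (rule tendsto_sandwich[OF _ _ tendsto_const R]) (use le in auto)
qed

text \<open>The graph of the convex function \<open>D powr p\<close> lies above its tangent at \<open>a\<close>.\<close>

lemma powr_tangent_le:
  fixes D a :: real
  assumes "1 \<le> p" "0 \<le> D" "0 < a"
  shows "p * a powr p * (D / a) - (p - 1) * a powr p \<le> D powr p"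
proof -
  have "((D / a) powr p) powr (1 / p) \<le> (1 / p) * (D / a) powr p + (1 - 1 / p)"
    using assms by (intro powr_le_affine) auto
  then have "D / a \<le> (1 / p) * (D / a) powr p + (1 - 1 / p)"
    using assms by (simp add: powr_powr)
  then have "p * (D / a) \<le> p * ((1 / p) * (D / a) powr p + (1 - 1 / p))"
    using assms by (intro mult_left_mono) auto
  also have "\<dots> = (D / a) powr p + (p - 1)"
    using assms by (simp add: distrib_left right_diff_distrib)
  finally have "p * (D / a) \<le> (D / a) powr p + (p - 1)" .
  then have "a powr p * (p * (D / a)) \<le> a powr p * ((D / a) powr p + (p - 1))"
    by (intro mult_left_mono) auto
  also have "\<dots> = D powr p + (p - 1) * a powr p"
    using assms by (simp add: powr_divide algebra_simps)
  finally show ?thesis by (simp add: algebra_simps)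
qed

text \<open>Jensen's inequality for the measure with density \<open>|k|\<close>, in a form that needs only an upper bound \<open>K\<close> for the total
  mass: integrate the tangent inequality at the point \<open>J / K\<close>, where \<open>J\<close> is the integral of \<open>|k| |D|\<close>.\<close>

lemma powr_integral_le:
  fixes k :: "real \<Rightarrow> real" and D :: "real \<Rightarrow> complex"
  assumes p: "1 \<le> p" and k: "continuous_on UNIV k" and D: "continuous_on UNIV D"
    and K: "(\<integral>\<theta>. \<bar>k \<theta>\<bar> \<partial>circle) \<le> K" "0 < K"
  shows "norm (\<integral>\<theta>. of_real (k \<theta>) * D \<theta> \<partial>circle) powr p
    \<le> K powr (p - 1) * (\<integral>\<theta>. \<bar>k \<theta>\<bar> * norm (D \<theta>) powr p \<partial>circle)"
proof -
  define J where "J = (\<integral>\<theta>. \<bar>k \<theta>\<bar> * norm (D \<theta>) \<partial>circle)"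
  define P where "P = (\<integral>\<theta>. \<bar>k \<theta>\<bar> * norm (D \<theta>) powr p \<partial>circle)"
  have J0: "0 \<le> J" and P0: "0 \<le> P" unfolding J_def P_def by (simp_all add: integral_nonneg_AE)
  have "norm (\<integral>\<theta>. of_real (k \<theta>) * D \<theta> \<partial>circle) \<le> J"
    unfolding J_def using integral_norm_bound[of circle "\<lambda>\<theta>. of_real (k \<theta>) * D \<theta>"] by (simp add: norm_mult)
  then have "norm (\<integral>\<theta>. of_real (k \<theta>) * D \<theta> \<partial>circle) powr p \<le> J powr p"
    using p by (intro powr_mono2) auto
  also have "\<dots> \<le> K powr (p - 1) * P"
  proof (cases "J = 0")
    case False
    define a where "a = J / K"
    have a: "a > 0" using False J0 K by (simp add: a_def)
    have cp: "continuous_on UNIV (\<lambda>\<theta>. \<bar>k \<theta>\<bar> * norm (D \<theta>) powr p)"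
      using p by (intro continuous_intros k D continuous_on_powr') auto
    have c1: "continuous_on UNIV (\<lambda>\<theta>. \<bar>k \<theta>\<bar> * norm (D \<theta>))" "continuous_on UNIV (\<lambda>\<theta>. \<bar>k \<theta>\<bar>)"
      by (intro continuous_intros k D)+
    have i: "integrable circle (\<lambda>\<theta>. (p * a powr p / a) * (\<bar>k \<theta>\<bar> * norm (D \<theta>)))"
        "integrable circle (\<lambda>\<theta>. ((p - 1) * a powr p) * \<bar>k \<theta>\<bar>)"
      by (intro integrable_mult_right circle_integrable c1)+
    have "(p * a powr p / a) * J - ((p - 1) * a powr p) * K
       \<le> (p * a powr p / a) * J - ((p - 1) * a powr p) * (\<integral>\<theta>. \<bar>k \<theta>\<bar> \<partial>circle)"
      using p K by (intro diff_left_mono mult_left_mono) auto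
    also have "\<dots> = (\<integral>\<theta>. (p * a powr p / a) * (\<bar>k \<theta>\<bar> * norm (D \<theta>)) - ((p - 1) * a powr p) * \<bar>k \<theta>\<bar> \<partial>circle)"
      unfolding J_def by (subst Bochner_Integration.integral_diff[OF i]) simp
    also have "\<dots> \<le> P"
      unfolding P_def
    proof (rule Bochner_Integration.integral_mono)
      show "integrable circle (\<lambda>\<theta>. (p * a powr p / a) * (\<bar>k \<theta>\<bar> * norm (D \<theta>)) - ((p - 1) * a powr p) * \<bar>k \<theta>\<bar>)"
        using i by (rule Bochner_Integration.integrable_diff)
      show "integrable circle (\<lambda>\<theta>. \<bar>k \<theta>\<bar> * norm (D \<theta>) powr p)" by (rule circle_integrable[OF cp])
      show "(p * a powr p / a) * (\<bar>k \<theta>\<bar> * norm (D \<theta>)) - ((p - 1) * a powr p) * \<bar>k \<theta>\<bar> \<le> \<bar>k \<theta>\<bar> * norm (D \<theta>) powr p" for \<theta>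
        using mult_left_mono[OF powr_tangent_le[OF p norm_ge_zero a, of "D \<theta>"], of "\<bar>k \<theta>\<bar>"]
        by (simp add: algebra_simps)
    qed
    also have "(p * a powr p / a) * J - ((p - 1) * a powr p) * K = a powr p * K"
      using K False by (simp add: a_def field_simps)
    also have "\<dots> = J powr p / K powr (p - 1)"
      using K J0 by (simp add: a_def powr_divide powr_diff)
    finally show ?thesis using K by (simp add: field_simps)
  qed (use P0 in auto)
  finally show ?thesis unfolding P_def .
qed

lemma lborel_circle_pair: "pair_sigma_finite circle (lborel :: (real \<times> real) measure)"
proof -
  interpret finite_measure circle by (rule circle_finite)
  show ?thesis by unfold_locales
qed

text \<open>Minkowski's integral inequality for averages over the circle: \<open>powr_integral_le\<close> at each point, then Tonelli.\<close>

lemma energy_average_le: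
  fixes k :: "real \<Rightarrow> real" and D :: "real \<Rightarrow> real \<times> real \<Rightarrow> complex"
  assumes p: "1 \<le> p" and k: "continuous_on UNIV k" and D: "continuous_on UNIV (\<lambda>x. D (fst x) (snd x))"
    and K: "(\<integral>\<theta>. \<bar>k \<theta>\<bar> \<partial>circle) \<le> K" "0 < K"
  shows "energy p (\<lambda>z. \<integral>\<theta>. of_real (k \<theta>) * D \<theta> z \<partial>circle)
    \<le> ennreal (K powr (p - 1)) * (\<integral>\<^sup>+\<theta>. ennreal \<bar>k \<theta>\<bar> * energy p (D \<theta>) \<partial>circle)"
proof -
  interpret pair_sigma_finite circle "lborel :: (real \<times> real) measure" by (rule lborel_circle_pair)
  define f where "f \<theta> z = \<bar>k \<theta>\<bar> * norm (D \<theta> z) powr p" for \<theta> z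
  have cf: "continuous_on UNIV (\<lambda>x. f (fst x) (snd x))"
    unfolding f_def using p
    by (intro continuous_intros continuous_on_powr' D continuous_on_compose2[OF k]) auto
  have "(\<lambda>x::real \<times> (real \<times> real). f (fst x) (snd x)) \<in> borel_measurable (borel \<Otimes>\<^sub>M borel)"
    using borel_measurable_continuous_onI[OF cf] by (simp add: borel_prod)
  moreover have "(\<lambda>x. (fst x, snd x)) \<in> circle \<Otimes>\<^sub>M (lborel :: (real \<times> real) measure) \<rightarrow>\<^sub>M (borel \<Otimes>\<^sub>M borel)"
    by (intro measurable_Pair measurable_compose[OF measurable_fst circle_measurable[of "\<lambda>x. x"]])
       (auto intro: measurable_compose[OF measurable_snd])
  ultimately have "(\<lambda>x. f (fst x) (snd x)) \<in> borel_measurable (circle \<Otimes>\<^sub>M lborel)"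
    using measurable_compose by fastforce
  then have fm: "(\<lambda>x. ennreal (f (fst x) (snd x))) \<in> borel_measurable (circle \<Otimes>\<^sub>M lborel)" by simp
  have pair: "continuous_on UNIV (\<lambda>\<theta>::real. (\<theta>, z))" "continuous_on UNIV (\<lambda>z::real \<times> real. (\<theta>, z))"
    for z :: "real \<times> real" and \<theta> :: real by (intro continuous_intros)+
  have c\<theta>: "continuous_on UNIV (\<lambda>\<theta>. f \<theta> z)" "continuous_on UNIV (\<lambda>\<theta>. D \<theta> z)" for z
    using continuous_on_compose2[OF cf pair(1)] continuous_on_compose2[OF D pair(1)] by auto
  have cz: "continuous_on UNIV (\<lambda>z. D \<theta> z)" for \<theta>
    using continuous_on_compose2[OF D pair(2)] by auto
  have f0: "0 \<le> f \<theta> z" for \<theta> z by (simp add: f_def)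
  have "energy p (\<lambda>z. \<integral>\<theta>. of_real (k \<theta>) * D \<theta> z \<partial>circle)
     \<le> (\<integral>\<^sup>+z. ennreal (K powr (p - 1)) * (\<integral>\<^sup>+\<theta>. ennreal (f \<theta> z) \<partial>circle) \<partial>lborel)"
    unfolding energy_def
  proof (rule nn_integral_mono)
    fix z
    have "(\<integral>\<^sup>+\<theta>. ennreal (f \<theta> z) \<partial>circle) = ennreal (\<integral>\<theta>. f \<theta> z \<partial>circle)"
      by (intro nn_integral_eq_integral circle_integrable c\<theta>) (simp add: f0)
    then show "ennreal (norm (\<integral>\<theta>. of_real (k \<theta>) * D \<theta> z \<partial>circle) powr p)
        \<le> ennreal (K powr (p - 1)) * (\<integral>\<^sup>+\<theta>. ennreal (f \<theta> z) \<partial>circle)"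
      using powr_integral_le[OF p k c\<theta>(2) K, of z]
      by (simp add: ennreal_mult'[symmetric] f_def ennreal_leI)
  qed
  also have "\<dots> = ennreal (K powr (p - 1)) * (\<integral>\<^sup>+z. (\<integral>\<^sup>+\<theta>. ennreal (f \<theta> z) \<partial>circle) \<partial>lborel)"
  proof (rule nn_integral_cmult)
    have "(\<lambda>x. ennreal (f (snd x) (fst x))) \<in> borel_measurable (lborel \<Otimes>\<^sub>M circle)"
      using measurable_pair_swap[OF fm] by (simp add: case_prod_beta)
    from M1.borel_measurable_nn_integral_fst[OF this]
    show "(\<lambda>z. \<integral>\<^sup>+\<theta>. ennreal (f \<theta> z) \<partial>circle) \<in> borel_measurable lborel" by simp
  qed
  also have "(\<integral>\<^sup>+z. (\<integral>\<^sup>+\<theta>. ennreal (f \<theta> z) \<partial>circle) \<partial>lborel) = (\<integral>\<^sup>+\<theta>. (\<integral>\<^sup>+z. ennreal (f \<theta> z) \<partial>lborel) \<partial>circle)"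
    by (rule Fubini') (use fm in \<open>simp add: case_prod_beta\<close>)
  also have "\<dots> = (\<integral>\<^sup>+\<theta>. ennreal \<bar>k \<theta>\<bar> * energy p (D \<theta>) \<partial>circle)"
  proof (rule nn_integral_cong)
    fix \<theta>
    have [measurable]: "D \<theta> \<in> borel_measurable borel" using cz by (rule borel_measurable_continuous_onI)
    show "(\<integral>\<^sup>+z. ennreal (f \<theta> z) \<partial>lborel) = ennreal \<bar>k \<theta>\<bar> * energy p (D \<theta>)"
      unfolding energy_def f_def by (simp add: ennreal_mult nn_integral_cmult)
  qed
  finally show ?thesis .
qed

section \<open>Riesz means of weighted power series\<close>

definition coeff_mult :: "(nat \<Rightarrow> real) \<Rightarrow> (nat \<Rightarrow> complex) \<Rightarrow> nat \<Rightarrow> complex" where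
  "coeff_mult w c n = of_real (w n) * c n"

lemma entire_summable: "entire_coeffs c \<Longrightarrow> summable (\<lambda>n. c n * s ^ n)"
  by (rule summable_norm_cancel) (simp add: entire_coeffs_def)

lemma entire_coeffs_diff:
  assumes "entire_coeffs c" "entire_coeffs d"
  shows "entire_coeffs (\<lambda>n. c n - d n)"
  unfolding entire_coeffs_def
proof
  fix s :: complex
  have "summable (\<lambda>n. norm (c n * s ^ n) + norm (d n * s ^ n))"
    using assms by (intro summable_add) (auto simp: entire_coeffs_def)
  then show "summable (\<lambda>n. norm ((c n - d n) * s ^ n))"
    by (rule summable_comparison_test') (simp add: left_diff_distrib norm_triangle_ineq4)
qed

lemma entire_coeffs_mult:
  assumes "entire_coeffs c" "\<And>n. \<bar>w n\<bar> \<le> 1"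
  shows "entire_coeffs (coeff_mult w c)"
  unfolding entire_coeffs_def
proof
  fix s :: complex
  have "summable (\<lambda>n. norm (c n * s ^ n))" using assms(1) by (auto simp: entire_coeffs_def)
  moreover have "norm (norm (coeff_mult w c n * s ^ n)) \<le> norm (c n * s ^ n)" for n
    using mult_right_mono[OF assms(2)[of n], of "norm (c n * s ^ n)"]
    by (simp add: coeff_mult_def norm_mult mult.assoc)
  ultimately show "summable (\<lambda>n. norm (coeff_mult w c n * s ^ n))"
    by (rule summable_comparison_test')
qed

lemma fock_diff:
  assumes "entire_coeffs c" "entire_coeffs d"
  shows "fock (\<lambda>n. c n - d n) z = fock c z - fock d z"
  unfolding fock_def left_diff_distrib
  by (subst suminf_diff[symmetric]) (auto intro: entire_summable assms simp: right_diff_distrib)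

lemma continuous_fock:
  assumes "entire_coeffs c" shows "continuous_on UNIV (fock c)"
proof -
  have "continuous_on UNIV (\<lambda>s. \<Sum>n. c n * s ^ n)"
    by (intro continuous_at_imp_continuous_on ballI isCont_powser_converges_everywhere entire_summable assms)
  moreover have "continuous_on UNIV fock_point"
    unfolding fock_point_def[abs_def] Complex_eq by (intro continuous_intros) auto
  ultimately have "continuous_on UNIV (\<lambda>z. \<Sum>n. c n * fock_point z ^ n)"
    by (rule continuous_on_compose2) auto
  then show ?thesis
    unfolding fock_def[abs_def] fock_weight_def by (intro continuous_intros)
qed

lemma fock_measurable: "entire_coeffs c \<Longrightarrow> fock c \<in> borel_measurable borel"
  by (rule borel_measurable_continuous_onI[OF continuous_fock])

lemma fock_rot_sums:
  assumes "entire_coeffs c"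
  shows "(\<lambda>n. of_real (fock_weight z) * (c n * fock_point z ^ n) * cis (- (real n * \<theta>))) sums fock c (rot \<theta> z)"
proof -
  have "(\<lambda>n. c n * fock_point (rot \<theta> z) ^ n) sums (\<Sum>n. c n * fock_point (rot \<theta> z) ^ n)"
    by (intro summable_sums entire_summable assms)
  from sums_mult[OF this, of "of_real (fock_weight (rot \<theta> z))"] show ?thesis
    by (simp add: fock_def fock_point_rot fock_weight_rot power_mult_distrib Complex.DeMoivre mult_ac)
qed

text \<open>A multiplier on power series is a convolution over rotations with any kernel that has the multiplier as its
  Fourier coefficients of nonnegative order; the coefficients of negative order are free, and the symmetric choice is made.\<close>

lemma fock_riesz_average:
  assumes c: "entire_coeffs c" and N: "N \<ge> 1"
  shows "fock (coeff_mult (riesz_weight \<beta> N) c) z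
    = (\<integral>\<theta>. of_real (riesz_kernel \<beta> N \<theta> / (2 * pi)) * fock c (rot \<theta> z) \<partial>circle)"
proof -
  define k where "k \<theta> = riesz_kernel \<beta> N \<theta> / (2 * pi)" for \<theta>
  define e where "e n = of_real (fock_weight z) * (c n * fock_point z ^ n)" for n
  have ck: "continuous_on UNIV k" unfolding k_def by (intro continuous_intros riesz_kernel_continuous) auto
  have e: "summable (\<lambda>n. norm (e n))"
    unfolding e_def norm_mult[of "of_real _"] using c by (intro summable_mult) (auto simp: entire_coeffs_def)
  define f where "f n \<theta> = e n * (of_real (k \<theta>) * cis (- (real n * \<theta>)))" for n \<theta>
  have f_sums: "(\<lambda>n. f n \<theta>) sums (of_real (k \<theta>) * fock c (rot \<theta> z))" for \<theta>
    using sums_mult[OF fock_rot_sums[OF c, of z \<theta>], of "of_real (k \<theta>)"]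
    by (simp add: f_def e_def mult_ac)
  have nf: "norm (f n \<theta>) = norm (e n) * \<bar>k \<theta>\<bar>" for n \<theta> by (simp add: f_def norm_mult)
  have int: "(\<integral>\<theta>. f n \<theta> \<partial>circle) = e n * of_real (riesz_weight \<beta> N n)" for n
  proof -
    have "(\<integral>\<theta>. f n \<theta> \<partial>circle)
        = (\<integral>\<theta>. e n / (2 * of_real pi) * (of_real (riesz_kernel \<beta> N \<theta>) * cis (- (real n * \<theta>))) \<partial>circle)"
      by (simp add: f_def k_def)
    also have "\<dots> = e n / (2 * of_real pi) * (2 * of_real pi * of_real (riesz_weight \<beta> N n))"
      unfolding integral_mult_right_zero integral_riesz_kernel_cis[OF N] ..
    finally show ?thesis by simp
  qed
  have "(\<lambda>n. \<integral>\<theta>. f n \<theta> \<partial>circle) sums (\<integral>\<theta>. (\<Sum>n. f n \<theta>) \<partial>circle)"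
  proof (rule sums_integral)
    show "integrable circle (f n)" for n
      unfolding f_def by (intro circle_integrable continuous_intros ck)
    show "AE \<theta> in circle. summable (\<lambda>n. norm (f n \<theta>))"
      unfolding nf by (intro AE_I2 summable_mult2 e)
    show "summable (\<lambda>n. \<integral>\<theta>. norm (f n \<theta>) \<partial>circle)"
      unfolding nf integral_mult_right_zero by (intro summable_mult2 e)
  qed
  then have "(\<lambda>n. e n * of_real (riesz_weight \<beta> N n)) sums (\<integral>\<theta>. of_real (k \<theta>) * fock c (rot \<theta> z) \<partial>circle)"
    unfolding int using f_sums by (simp add: sums_iff)
  moreover have "(\<lambda>n. e n * of_real (riesz_weight \<beta> N n)) sums fock (coeff_mult (riesz_weight \<beta> N) c) z"
  proof -
    have "summable (\<lambda>n. coeff_mult (riesz_weight \<beta> N) c n * fock_point z ^ n)"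
      by (rule summable_finite[of "{..N}"]) (auto simp: coeff_mult_def riesz_weight_def)
    from sums_mult[OF summable_sums[OF this], of "of_real (fock_weight z)"] show ?thesis
      by (simp add: fock_def e_def coeff_mult_def mult_ac)
  qed
  ultimately show ?thesis unfolding k_def using sums_unique2 by blast
qed

lemma integral_riesz_kernel:
  assumes "N \<ge> 1"
  shows "(\<integral>\<theta>. of_real (riesz_kernel \<beta> N \<theta> / (2 * pi)) * (c :: complex) \<partial>circle) = c"
proof -
  have "(\<integral>\<theta>. complex_of_real (riesz_kernel \<beta> N \<theta>) \<partial>circle) = 2 * of_real pi"
    using integral_riesz_kernel_cis[OF assms, of \<beta> 0] by (simp add: riesz_weight_def)
  then have "(\<integral>\<theta>. riesz_kernel \<beta> N \<theta> \<partial>circle) = 2 * pi"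
    unfolding integral_complex_of_real by (metis of_real_eq_iff of_real_mult of_real_numeral)
  then show ?thesis by (simp add: integral_mult_left_zero)
qed

text \<open>An integrable majorant, uniform in \<open>N\<close>, of the kernel rescaled to width one.\<close>

definition decay :: "real \<Rightarrow> real \<Rightarrow> real" where
  "decay \<beta> x = 800 * (1 + \<bar>x\<bar>) powr (- 1 - \<beta>)"

lemma decay_measurable [measurable]: "decay \<beta> \<in> borel_measurable borel"
  unfolding decay_def[abs_def] by measurable

lemma decay_nonneg: "0 \<le> decay \<beta> x" by (simp add: decay_def)

lemma nn_integral_decay:
  assumes "\<beta> > 0" shows "(\<integral>\<^sup>+x. ennreal (decay \<beta> x) \<partial>lborel) = ennreal (\<integral>x. decay \<beta> x \<partial>lborel)"
  unfolding decay_def using assms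
  by (intro nn_integral_eq_integral integrable_mult_right integrable_powr_decay) auto

text \<open>Substitute \<open>\<theta> = x / N\<close>. The right-hand side has the fixed density \<open>decay \<beta>\<close>, so that letting \<open>N\<close> tend to infinity
  becomes an instance of dominated convergence.\<close>

lemma nn_integral_riesz_kernel_le:
  assumes \<beta>: "0 < \<beta>" "\<beta> \<le> 1" and N: "N \<ge> 1" and [measurable]: "\<Omega> \<in> borel_measurable borel"
  shows "(\<integral>\<^sup>+\<theta>. ennreal \<bar>riesz_kernel \<beta> N \<theta> / (2 * pi)\<bar> * \<Omega> \<theta> \<partial>circle)
    \<le> (\<integral>\<^sup>+x. ennreal (decay \<beta> x) * (\<Omega> (x / real N) * indicator {-pi..pi} (x / real N)) \<partial>lborel)"
proof -
  have "(\<integral>\<^sup>+\<theta>. ennreal \<bar>riesz_kernel \<beta> N \<theta> / (2 * pi)\<bar> * \<Omega> \<theta> \<partial>circle)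
     = (\<integral>\<^sup>+\<theta>. ennreal \<bar>riesz_kernel \<beta> N \<theta> / (2 * pi)\<bar> * \<Omega> \<theta> * indicator {-pi..pi} \<theta> \<partial>lborel)"
    unfolding circle_def by (rule nn_integral_restrict_space) simp
  also have "\<dots> \<le> (\<integral>\<^sup>+\<theta>. ennreal (real N) * (ennreal (decay \<beta> (real N * \<theta>)) * (\<Omega> \<theta> * indicator {-pi..pi} \<theta>)) \<partial>lborel)"
  proof (rule nn_integral_mono)
    fix \<theta> :: real
    show "ennreal \<bar>riesz_kernel \<beta> N \<theta> / (2 * pi)\<bar> * \<Omega> \<theta> * indicator {-pi..pi} \<theta>
       \<le> ennreal (real N) * (ennreal (decay \<beta> (real N * \<theta>)) * (\<Omega> \<theta> * indicator {-pi..pi} \<theta>))"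
    proof (cases "\<theta> \<in> {-pi..pi}")
      case True
      have "\<bar>riesz_kernel \<beta> N \<theta> / (2 * pi)\<bar> \<le> \<bar>riesz_kernel \<beta> N \<theta>\<bar> / 1"
        unfolding abs_divide using pi_ge_two by (intro divide_left_mono) auto
      also have "\<dots> \<le> real N * decay \<beta> (real N * \<theta>)"
        using riesz_kernel_bound[OF \<beta> N, of \<theta>] True by (simp add: decay_def abs_mult abs_le_iff)
      finally have "ennreal \<bar>riesz_kernel \<beta> N \<theta> / (2 * pi)\<bar> \<le> ennreal (real N) * ennreal (decay \<beta> (real N * \<theta>))"
        by (simp add: ennreal_mult[symmetric] decay_nonneg ennreal_leI)
      then show ?thesis using True by (simp add: mult_right_mono mult.assoc[symmetric])
    qed simp
  qed
  also have "\<dots> = ennreal (real N) * (\<integral>\<^sup>+\<theta>. ennreal (decay \<beta> (real N * \<theta>)) * (\<Omega> \<theta> * indicator {-pi..pi} \<theta>) \<partial>lborel)"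
    by (rule nn_integral_cmult) measurable
  also have "\<dots> = (\<integral>\<^sup>+x. ennreal (decay \<beta> x) * (\<Omega> (x / real N) * indicator {-pi..pi} (x / real N)) \<partial>lborel)"
  proof -
    have "(\<integral>\<^sup>+x. ennreal (decay \<beta> x) * (\<Omega> (x / real N) * indicator {-pi..pi} (x / real N)) \<partial>lborel)
      = ennreal \<bar>real N\<bar> * (\<integral>\<^sup>+\<theta>. ennreal (decay \<beta> (0 + real N * \<theta>)) * (\<Omega> ((0 + real N * \<theta>) / real N) * indicator {-pi..pi} ((0 + real N * \<theta>) / real N)) \<partial>lborel)"
      using N by (intro nn_integral_real_affine) auto
    then show ?thesis using N by simp
  qed
  finally show ?thesis .
qed

text \<open>The summand \<open>1\<close> makes the bound positive without further argument.\<close>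

definition kernel_bound :: "real \<Rightarrow> real" where
  "kernel_bound \<beta> = 1 + (\<integral>x. decay \<beta> x \<partial>lborel)"

lemma kernel_bound_pos: "0 < kernel_bound \<beta>"
  unfolding kernel_bound_def by (intro add_pos_nonneg integral_nonneg_AE) (auto simp: decay_nonneg)

lemma nn_integral_riesz_kernel_bound:
  assumes \<beta>: "0 < \<beta>" "\<beta> \<le> 1" and N: "N \<ge> 1"
  shows "(\<integral>\<^sup>+\<theta>. ennreal \<bar>riesz_kernel \<beta> N \<theta> / (2 * pi)\<bar> \<partial>circle) \<le> ennreal (kernel_bound \<beta>)"
proof -
  have "(\<integral>\<^sup>+\<theta>. ennreal \<bar>riesz_kernel \<beta> N \<theta> / (2 * pi)\<bar> * 1 \<partial>circle)
    \<le> (\<integral>\<^sup>+x. ennreal (decay \<beta> x) * (1 * indicator {-pi..pi} (x / real N)) \<partial>lborel)"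
    by (rule nn_integral_riesz_kernel_le[OF \<beta> N]) simp
  also have "\<dots> \<le> (\<integral>\<^sup>+x. ennreal (decay \<beta> x) \<partial>lborel)"
    by (intro nn_integral_mono) (auto simp: indicator_def)
  also have "\<dots> \<le> ennreal (kernel_bound \<beta>)"
    unfolding nn_integral_decay[OF \<beta>(1)] kernel_bound_def by (intro ennreal_leI) simp
  finally show ?thesis by simp
qed

lemma integral_riesz_kernel_bound:
  assumes \<beta>: "0 < \<beta>" "\<beta> \<le> 1" and N: "N \<ge> 1"
  shows "(\<integral>\<theta>. \<bar>riesz_kernel \<beta> N \<theta> / (2 * pi)\<bar> \<partial>circle) \<le> kernel_bound \<beta>"
proof -
  have "integrable circle (\<lambda>\<theta>. \<bar>riesz_kernel \<beta> N \<theta> / (2 * pi)\<bar>)"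
    by (intro circle_integrable continuous_intros riesz_kernel_continuous) auto
  then have "ennreal (\<integral>\<theta>. \<bar>riesz_kernel \<beta> N \<theta> / (2 * pi)\<bar> \<partial>circle) \<le> ennreal (kernel_bound \<beta>)"
    using nn_integral_riesz_kernel_bound[OF assms] by (subst (asm) nn_integral_eq_integral) auto
  then show ?thesis using kernel_bound_pos[of \<beta>] by (simp add: ennreal_le_iff)
qed

lemma energy_riesz_le:
  assumes p: "1 \<le> p" and \<beta>: "0 < \<beta>" "\<beta> \<le> 1" and N: "N \<ge> 1" and c: "entire_coeffs c"
  shows "energy p (fock (coeff_mult (riesz_weight \<beta> N) c)) \<le> ennreal (kernel_bound \<beta> powr p) * energy p (fock c)"
proof -
  define K where "K = kernel_bound \<beta>"
  have K: "0 < K" unfolding K_def by (rule kernel_bound_pos)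
  define k where "k \<theta> = riesz_kernel \<beta> N \<theta> / (2 * pi)" for \<theta>
  have ck: "continuous_on UNIV k" unfolding k_def by (intro continuous_intros riesz_kernel_continuous) auto
  have "energy p (fock (coeff_mult (riesz_weight \<beta> N) c))
     = energy p (\<lambda>z. \<integral>\<theta>. of_real (k \<theta>) * fock c (rot \<theta> z) \<partial>circle)"
    unfolding k_def fock_riesz_average[OF c N, symmetric] ..
  also have "\<dots> \<le> ennreal (K powr (p - 1)) * (\<integral>\<^sup>+\<theta>. ennreal \<bar>k \<theta>\<bar> * energy p (\<lambda>z. fock c (rot \<theta> z)) \<partial>circle)"
    unfolding k_def K_def
    by (intro energy_average_le p ck[unfolded k_def] integral_riesz_kernel_bound[OF \<beta> N] kernel_bound_pos
        continuous_on_compose2[OF continuous_fock[OF c] continuous_rot]) auto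
  also have "(\<integral>\<^sup>+\<theta>. ennreal \<bar>k \<theta>\<bar> * energy p (\<lambda>z. fock c (rot \<theta> z)) \<partial>circle) = (\<integral>\<^sup>+\<theta>. ennreal \<bar>k \<theta>\<bar> * energy p (fock c) \<partial>circle)"
    by (intro nn_integral_cong) (auto simp: space_circle energy_rot[OF fock_measurable[OF c]] abs_le_iff)
  also have "\<dots> = (\<integral>\<^sup>+\<theta>. ennreal \<bar>k \<theta>\<bar> \<partial>circle) * energy p (fock c)"
    using borel_measurable_continuous_onI[OF ck] by (intro nn_integral_multc circle_measurable) auto
  also have "\<dots> \<le> ennreal K * energy p (fock c)"
    unfolding k_def K_def by (intro mult_right_mono nn_integral_riesz_kernel_bound[OF \<beta> N]) auto
  also have "ennreal (K powr (p - 1)) * (ennreal K * energy p (fock c)) = ennreal (K powr p) * energy p (fock c)"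
  proof -
    have "K powr (p - 1) * K = K powr p" using K by (simp add: powr_diff)
    then show ?thesis using K by (simp add: mult.assoc[symmetric] ennreal_mult[symmetric])
  qed
  finally show ?thesis unfolding K_def by (simp add: mult_left_mono)
qed

text \<open>The kernel has mean one, so the error is an average of the differences between \<open>u\<close> and its rotations. The energy
  \<open>\<Omega> \<theta>\<close> of these differences is bounded and tends to zero with \<open>\<theta>\<close>, while the kernels concentrate at zero.\<close>

lemma energy_riesz_tendsto:
  assumes p: "1 \<le> p" and \<beta>: "0 < \<beta>" "\<beta> \<le> 1" and c: "entire_coeffs c" and fin: "energy p (fock c) < \<infinity>"
  shows "(\<lambda>N. energy p (\<lambda>z. fock (coeff_mult (riesz_weight \<beta> N) c) z - fock c z)) \<longlonglongrightarrow> 0"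
proof -
  define K where "K = kernel_bound \<beta>"
  have K: "0 < K" unfolding K_def by (rule kernel_bound_pos)
  define u where "u = fock c"
  have cu: "continuous_on UNIV u" and um [measurable]: "u \<in> borel_measurable borel"
    unfolding u_def using continuous_fock[OF c] fock_measurable[OF c] .
  define \<Omega> where "\<Omega> \<theta> = energy p (\<lambda>z. u (rot \<theta> z) - u z)" for \<theta>
  have cD: "continuous_on UNIV (\<lambda>x. u (rot (fst x) (snd x)) - u (snd x))"
    by (intro continuous_intros continuous_on_compose2[OF cu continuous_rot] continuous_on_compose2[OF cu]) auto
  have \<Omega>m [measurable]: "\<Omega> \<in> borel_measurable borel"
  proof -
    have "(\<lambda>x::real \<times> (real \<times> real). u (rot (fst x) (snd x)) - u (snd x)) \<in> borel_measurable (borel \<Otimes>\<^sub>M borel)"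
      using borel_measurable_continuous_onI[OF cD] by (simp add: borel_prod)
    then have "(\<lambda>x::real \<times> (real \<times> real). ennreal (norm (u (rot (fst x) (snd x)) - u (snd x)) powr p)) \<in> borel_measurable (borel \<Otimes>\<^sub>M lborel)"
      by (simp cong: measurable_cong_sets sets_pair_measure_cong)
    from lborel.borel_measurable_nn_integral_fst[OF this] show ?thesis
      by (simp add: \<Omega>_def[abs_def] energy_def)
  qed
  define B where "B = ennreal (2 powr p) * (energy p u + energy p u)"
  have B: "B < \<infinity>" using fin unfolding B_def u_def by (auto simp: ennreal_mult_less_top ennreal_add_less_top less_top)
  have \<Omega>B: "\<Omega> \<theta> \<le> B" if "\<bar>\<theta>\<bar> \<le> pi" for \<theta>
  proof -
    have "energy p (\<lambda>z. u (rot \<theta> z) + - u z) \<le> ennreal (2 powr p) * (energy p (\<lambda>z. u (rot \<theta> z)) + energy p (\<lambda>z. - u z))"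
      using p by (intro energy_add_le) (auto intro: measurable_compose[OF rot_measurable um])
    also have "energy p (\<lambda>z. - u z) = energy p u" by (simp add: energy_def)
    finally show ?thesis by (simp add: \<Omega>_def B_def energy_rot[OF um that])
  qed
  define G where "G N x = ennreal (decay \<beta> x) * (\<Omega> (x / real N) * indicator {-pi..pi} (x / real N))" for N x
  have le: "energy p (\<lambda>z. fock (coeff_mult (riesz_weight \<beta> N) c) z - fock c z)
      \<le> ennreal (K powr (p - 1)) * (\<integral>\<^sup>+x. G N x \<partial>lborel)" if N: "N \<ge> 1" for N
  proof -
    define k where "k \<theta> = riesz_kernel \<beta> N \<theta> / (2 * pi)" for \<theta>
    have ck: "continuous_on UNIV k" unfolding k_def by (intro continuous_intros riesz_kernel_continuous) auto
    have "fock (coeff_mult (riesz_weight \<beta> N) c) z - fock c z = (\<integral>\<theta>. of_real (k \<theta>) * (u (rot \<theta> z) - u z) \<partial>circle)" for z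
    proof -
      have "continuous_on UNIV (\<lambda>\<theta>. u (rot \<theta> z))"
        by (rule continuous_on_compose2[OF cu]) (auto simp: rot_def intro!: continuous_intros)
      then have i: "integrable circle (\<lambda>\<theta>. of_real (k \<theta>) * u (rot \<theta> z))" "integrable circle (\<lambda>\<theta>. of_real (k \<theta>) * u z)"
        using ck by (auto intro!: circle_integrable continuous_intros)
      show ?thesis
        unfolding right_diff_distrib Bochner_Integration.integral_diff[OF i]
        unfolding k_def u_def fock_riesz_average[OF c N] integral_riesz_kernel[OF N] ..
    qed
    then have "energy p (\<lambda>z. fock (coeff_mult (riesz_weight \<beta> N) c) z - fock c z)
      = energy p (\<lambda>z. \<integral>\<theta>. of_real (k \<theta>) * (u (rot \<theta> z) - u z) \<partial>circle)" by simp
    also have "\<dots> \<le> ennreal (K powr (p - 1)) * (\<integral>\<^sup>+\<theta>. ennreal \<bar>k \<theta>\<bar> * \<Omega> \<theta> \<partial>circle)"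
      unfolding k_def K_def \<Omega>_def
      by (intro energy_average_le p ck[unfolded k_def] integral_riesz_kernel_bound[OF \<beta> N] kernel_bound_pos cD)
    also have "\<dots> \<le> ennreal (K powr (p - 1)) * (\<integral>\<^sup>+x. G N x \<partial>lborel)"
      unfolding k_def G_def by (intro mult_left_mono nn_integral_riesz_kernel_le[OF \<beta> N \<Omega>m]) auto
    finally show ?thesis .
  qed
  have "(\<lambda>N. \<integral>\<^sup>+x. G N x \<partial>lborel) \<longlonglongrightarrow> (\<integral>\<^sup>+x. 0 \<partial>(lborel :: real measure))"
  proof (rule nn_integral_dominated_convergence[where w = "\<lambda>x. ennreal (decay \<beta> x) * B"])
    show "G N \<in> borel_measurable lborel" for N unfolding G_def by measurable
    show "(\<lambda>x. ennreal (decay \<beta> x) * B) \<in> borel_measurable lborel" by measurable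
    show "AE x in lborel. G N x \<le> ennreal (decay \<beta> x) * B" for N
      unfolding G_def using \<Omega>B by (intro AE_I2 mult_left_mono) (auto simp: indicator_def abs_le_iff)
    show "(\<integral>\<^sup>+x. ennreal (decay \<beta> x) * B \<partial>lborel) < \<infinity>"
      using B by (simp add: nn_integral_multc nn_integral_decay[OF \<beta>(1)] ennreal_mult_less_top)
    have "(\<lambda>N. G N x) \<longlonglongrightarrow> 0" for x
    proof -
      \<comment> \<open>for small \<open>N\<close> the rescaled angle may leave the interval, and there \<open>G N x\<close> is zero\<close>
      define \<theta> where "\<theta> N = (if \<bar>x / real N\<bar> \<le> pi then x / real N else 0)" for N
      have "(\<lambda>N. x / real N) \<longlonglongrightarrow> 0" by (rule lim_const_over_n)
      then have "(\<lambda>N. norm (x / real N)) \<longlonglongrightarrow> 0" by (rule tendsto_norm_zero)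
      then have \<theta>: "\<theta> \<longlonglongrightarrow> 0"
        by (rule Lim_null_comparison[rotated]) (simp add: \<theta>_def)
      have "\<bar>\<theta> N\<bar> \<le> pi" for N by (simp add: \<theta>_def)
      then have "(\<lambda>N. \<Omega> (\<theta> N)) \<longlonglongrightarrow> 0"
        unfolding \<Omega>_def using p fin by (intro energy_rot_diff_tendsto cu \<theta>) (auto simp: u_def)
      then have lim: "(\<lambda>N. ennreal (decay \<beta> x) * \<Omega> (\<theta> N)) \<longlonglongrightarrow> ennreal (decay \<beta> x) * 0"
        by (intro ennreal_tendsto_cmult) auto
      have "G N x \<le> ennreal (decay \<beta> x) * \<Omega> (\<theta> N)" for N
        unfolding G_def by (intro mult_left_mono) (auto simp: \<theta>_def indicator_def abs_le_iff)
      then show ?thesis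
        using lim by (intro tendsto_sandwich[OF _ _ tendsto_const lim[simplified]]) auto
    qed
    then show "AE x in lborel. (\<lambda>N. G N x) \<longlonglongrightarrow> 0" by simp
  qed simp
  then have lim: "(\<lambda>N. \<integral>\<^sup>+x. G N x \<partial>lborel) \<longlonglongrightarrow> 0" by simp
  have "(\<lambda>N. ennreal (K powr (p - 1)) * (\<integral>\<^sup>+x. G N x \<partial>lborel)) \<longlonglongrightarrow> ennreal (K powr (p - 1)) * 0"
    by (intro ennreal_tendsto_cmult lim) auto
  then have lim': "(\<lambda>N. ennreal (K powr (p - 1)) * (\<integral>\<^sup>+x. G N x \<partial>lborel)) \<longlonglongrightarrow> 0" by simp
  show ?thesis
    by (rule tendsto_sandwich[OF _ _ tendsto_const lim'])
       (auto intro: le simp: eventually_sequentially intro!: exI[of _ 1])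
qed

text \<open>Families of multipliers that act uniformly boundedly and converge strongly to the identity. The condition on
  the size of the multipliers keeps the coefficients entire.\<close>

definition approximating :: "real \<Rightarrow> (nat \<Rightarrow> nat \<Rightarrow> real) \<Rightarrow> bool" where
  "approximating p w \<longleftrightarrow> (\<forall>N n. \<bar>w N n\<bar> \<le> 1)
    \<and> (\<exists>C::real. \<forall>N\<ge>1. \<forall>c. entire_coeffs c \<longrightarrow> energy p (fock (coeff_mult (w N) c)) \<le> ennreal C * energy p (fock c))
    \<and> (\<forall>c. entire_coeffs c \<and> energy p (fock c) < \<infinity> \<longrightarrow>
        (\<lambda>N. energy p (\<lambda>z. fock (coeff_mult (w N) c) z - fock c z)) \<longlonglongrightarrow> 0)"

lemma riesz_weight_le_1: "\<alpha> > 0 \<Longrightarrow> \<bar>riesz_weight \<alpha> N n\<bar> \<le> 1"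
  using riesz_base_nonneg[of n N] powr_mono2[of \<alpha> "1 - (real n)\<^sup>2 / (real N)\<^sup>2" 1]
  by (auto simp: riesz_weight_def)

lemma approximating_riesz:
  assumes "1 \<le> p" "0 < \<beta>" "\<beta> \<le> 1"
  shows "approximating p (riesz_weight \<beta>)"
  unfolding approximating_def
  using energy_riesz_le[OF assms] energy_riesz_tendsto[OF assms] riesz_weight_le_1[OF assms(2)] by blast

text \<open>With multipliers written as operators, \<open>W V c - c = W (V c - c) + (W c - c)\<close>; the first summand is controlled by
  the uniform bound for \<open>W\<close> and the convergence of \<open>V\<close>.\<close>

lemma approximating_mult:
  assumes p: "1 \<le> p" and w: "approximating p w" and v: "approximating p v"
  shows "approximating p (\<lambda>N n. w N n * v N n)"
proof -
  obtain Cw :: real where Cw: "\<And>N c. N \<ge> 1 \<Longrightarrow> entire_coeffs c \<Longrightarrow> energy p (fock (coeff_mult (w N) c)) \<le> ennreal Cw * energy p (fock c)"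
    using w unfolding approximating_def by blast
  obtain Cv :: real where Cv: "\<And>N c. N \<ge> 1 \<Longrightarrow> entire_coeffs c \<Longrightarrow> energy p (fock (coeff_mult (v N) c)) \<le> ennreal Cv * energy p (fock c)"
    using v unfolding approximating_def by blast
  have w1: "\<bar>w N n\<bar> \<le> 1" and v1: "\<bar>v N n\<bar> \<le> 1" for N n using w v unfolding approximating_def by auto
  have eq: "coeff_mult (\<lambda>n. w N n * v N n) c = coeff_mult (w N) (coeff_mult (v N) c)" for N c
    by (simp add: coeff_mult_def fun_eq_iff)
  have ent: "entire_coeffs (coeff_mult (w N) c)" "entire_coeffs (coeff_mult (v N) c)" if "entire_coeffs c" for N c
    using entire_coeffs_mult that w1 v1 by auto
  show ?thesis
    unfolding approximating_def
  proof (intro conjI allI impI)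
    show "\<bar>w N n * v N n\<bar> \<le> 1" for N n
      unfolding abs_mult using mult_le_one[OF w1 abs_ge_zero v1] .
    show "\<exists>C::real. \<forall>N\<ge>1. \<forall>c. entire_coeffs c \<longrightarrow>
        energy p (fock (coeff_mult (\<lambda>n. w N n * v N n) c)) \<le> ennreal C * energy p (fock c)"
    proof (intro exI[of _ "max 0 Cw * max 0 Cv"] allI impI)
      fix N c assume N: "1 \<le> (N::nat)" and c: "entire_coeffs c"
      have "energy p (fock (coeff_mult (\<lambda>n. w N n * v N n) c)) \<le> ennreal Cw * energy p (fock (coeff_mult (v N) c))"
        unfolding eq by (rule Cw[OF N ent(2)[OF c]])
      also have "\<dots> \<le> ennreal Cw * (ennreal Cv * energy p (fock c))"
        by (intro mult_left_mono Cv N c) auto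
      also have "\<dots> = ennreal (max 0 Cw * max 0 Cv) * energy p (fock c)"
        by (simp add: mult.assoc[symmetric] ennreal_mult' max_def ennreal_neg)
      finally show "energy p (fock (coeff_mult (\<lambda>n. w N n * v N n) c)) \<le> ennreal (max 0 Cw * max 0 Cv) * energy p (fock c)" .
    qed
  next
    fix c assume "entire_coeffs c \<and> energy p (fock c) < \<infinity>"
    then have c: "entire_coeffs c" and fin: "energy p (fock c) < \<infinity>" by auto
    define W where "W N = energy p (\<lambda>z. fock (coeff_mult (w N) c) z - fock c z)" for N
    define V where "V N = energy p (\<lambda>z. fock (coeff_mult (v N) c) z - fock c z)" for N
    have lim: "W \<longlonglongrightarrow> 0" "V \<longlonglongrightarrow> 0"
      using w v c fin unfolding approximating_def W_def V_def by auto
    have le: "energy p (\<lambda>z. fock (coeff_mult (\<lambda>n. w N n * v N n) c) z - fock c z)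
        \<le> ennreal (2 powr p) * (ennreal Cw * V N + W N)" if N: "N \<ge> 1" for N
    proof -
      \<comment> \<open>the error of \<open>V\<close>, to which \<open>W\<close> is applied\<close>
      define d where "d n = coeff_mult (v N) c n - c n" for n
      have d: "entire_coeffs d" unfolding d_def by (intro entire_coeffs_diff ent c)
      have fd: "fock d z = fock (coeff_mult (v N) c) z - fock c z" for z
        unfolding d_def by (intro fock_diff ent c)
      have "coeff_mult (w N) d = (\<lambda>n. coeff_mult (w N) (coeff_mult (v N) c) n - coeff_mult (w N) c n)"
        by (simp add: d_def coeff_mult_def fun_eq_iff right_diff_distrib)
      then have fw: "fock (coeff_mult (w N) d) z = fock (coeff_mult (w N) (coeff_mult (v N) c)) z - fock (coeff_mult (w N) c) z" for z
        using fock_diff[OF ent(1)[OF ent(2)[OF c]] ent(1)[OF c]] by simp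
      have "energy p (\<lambda>z. fock (coeff_mult (\<lambda>n. w N n * v N n) c) z - fock c z)
          = energy p (\<lambda>z. fock (coeff_mult (w N) d) z + (fock (coeff_mult (w N) c) z - fock c z))"
        unfolding eq fw by simp
      also have "\<dots> \<le> ennreal (2 powr p) * (energy p (fock (coeff_mult (w N) d)) + W N)"
        unfolding W_def using p
        by (intro energy_add_le borel_measurable_diff fock_measurable ent c d) auto
      also have "\<dots> \<le> ennreal (2 powr p) * (ennreal Cw * energy p (fock d) + W N)"
        by (intro mult_left_mono add_right_mono Cw N d) auto
      also have "energy p (fock d) = V N" unfolding V_def fd[abs_def, symmetric] by simp
      finally show ?thesis .
    qed
    have "(\<lambda>N. ennreal (2 powr p) * (ennreal Cw * V N + W N)) \<longlonglongrightarrow> ennreal (2 powr p) * (ennreal Cw * 0 + 0)"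
      by (intro ennreal_tendsto_cmult tendsto_add lim) auto
    then have lim': "(\<lambda>N. ennreal (2 powr p) * (ennreal Cw * V N + W N)) \<longlonglongrightarrow> 0" by simp
    show "(\<lambda>N. energy p (\<lambda>z. fock (coeff_mult (\<lambda>n. w N n * v N n) c) z - fock c z)) \<longlonglongrightarrow> 0"
      by (rule tendsto_sandwich[OF _ _ tendsto_const lim'])
         (auto intro: le simp: eventually_sequentially intro!: exI[of _ 1])
  qed
qed

text \<open>The weights of exponent \<open>\<alpha>\<close> are a power of the weights of exponent \<open>\<alpha> / (m + 1)\<close>, which is at most one
  for large \<open>m\<close>.\<close>

lemma approximating_riesz_all:
  assumes p: "1 \<le> p" and \<alpha>: "\<alpha> > 0"
  shows "approximating p (riesz_weight \<alpha>)"
proof -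
  define m where "m = nat \<lceil>\<alpha>\<rceil>"
  define \<beta> where "\<beta> = \<alpha> / real (Suc m)"
  have "\<alpha> \<le> real m" unfolding m_def using \<alpha> by simp
  then have \<beta>: "0 < \<beta>" "\<beta> \<le> 1" using \<alpha> by (auto simp: \<beta>_def)
  have powers: "approximating p (\<lambda>N n. riesz_weight \<beta> N n ^ Suc j)" for j
  proof (induction j)
    case (Suc j)
    have "approximating p (\<lambda>N n. riesz_weight \<beta> N n * riesz_weight \<beta> N n ^ Suc j)"
      by (rule approximating_mult[OF p approximating_riesz[OF p \<beta>] Suc])
    then show ?case by simp
  qed (simp add: approximating_riesz[OF p \<beta>])
  have "riesz_weight \<beta> N n ^ Suc m = riesz_weight \<alpha> N n" for N n
  proof (cases "n \<le> N")
    case True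
    have "real (Suc m) * \<beta> = \<alpha>" by (simp add: \<beta>_def)
    then have "(x powr \<beta>) ^ Suc m = x powr \<alpha>" if "x \<noteq> 0" for x :: real
      by (simp only: powr_power[OF that])
    then have "(x powr \<beta>) ^ Suc m = x powr \<alpha>" for x :: real by (cases "x = 0") auto
    then show ?thesis using True by (simp add: riesz_weight_def del: power_Suc)
  qed (simp add: riesz_weight_def)
  then have "(\<lambda>N n. riesz_weight \<beta> N n ^ Suc m) = riesz_weight \<alpha>" by (intro ext)
  with powers[of m] show ?thesis by (simp only:)
qed

section \<open>Convergence in modulation spaces\<close>

lemma modulation_integral_eq_energy:
  assumes "tempered_distribution T"
  shows "modulation_integral p T = energy p (fock (hermite_coeff T))"
  unfolding modulation_integral_def energy_def pairing_tf_shift[OF assms]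
  by (simp add: norm_mult norm_exp_eq_Re)

lemma modulation_integral_diff_eq_energy:
  assumes "tempered_distribution S" "tempered_distribution T"
  shows "modulation_integral p (\<lambda>g. S g - T g)
    = energy p (\<lambda>z. fock (hermite_coeff S) z - fock (hermite_coeff T) z)"
proof -
  have "pairing (\<lambda>g. S g - T g) g = pairing S g - pairing T g" for g by (simp add: pairing_def)
  then show ?thesis
    unfolding modulation_integral_def energy_def
    by (simp add: pairing_tf_shift[OF assms(1)] pairing_tf_shift[OF assms(2)]
        right_diff_distrib[symmetric] norm_mult norm_exp_eq_Re)
qed

lemma modulation_norm_tendsto_0:
  assumes p: "p > 0" and lim: "(\<lambda>N. modulation_integral p (T N)) \<longlonglongrightarrow> 0"
  shows "(\<lambda>N. modulation_norm p (T N)) \<longlonglongrightarrow> 0"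
proof -
  have "(\<lambda>N. enn2real (modulation_integral p (T N))) \<longlonglongrightarrow> 0"
    using tendsto_enn2real[where u = "\<lambda>N. modulation_integral p (T N)" and l = 0] lim by simp
  then have "(\<lambda>N. enn2real (modulation_integral p (T N)) powr (1 / p)) \<longlonglongrightarrow> 0 powr (1 / p)"
    using p by (intro tendsto_powr' tendsto_const) auto
  then have "(\<lambda>N. ennreal (enn2real (modulation_integral p (T N)) powr (1 / p))) \<longlonglongrightarrow> 0"
    using tendsto_ennrealI by fastforce
  moreover have "eventually (\<lambda>N. ennreal (enn2real (modulation_integral p (T N)) powr (1 / p)) = modulation_norm p (T N)) sequentially"
  proof -
    have "eventually (\<lambda>N. modulation_integral p (T N) < 1) sequentially"
      using order_tendstoD(2)[OF lim, of 1] by simp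
    then show ?thesis by eventually_elim (auto simp: modulation_norm_def)
  qed
  ultimately show ?thesis by (rule Lim_transform_eventually)
qed

theorem proposition1p4:
  fixes p \<alpha> :: real and f :: "(real \<Rightarrow> complex) \<Rightarrow> complex"
  assumes "1 \<le> p"
    and "f \<in> modulation_space p"
    and "\<alpha> > 0"
  shows "(\<forall>N\<ge>1. distribution_of (bochner_riesz \<alpha> N f) \<in> modulation_space p) \<and>
    ((\<lambda>N. modulation_norm p (\<lambda>g. distribution_of (bochner_riesz \<alpha> N f) g - f g))
      \<longlongrightarrow> 0) sequentially"
proof -
  have f: "tempered_distribution f" and "modulation_integral p f < \<infinity>"
    using assms(2) by (auto simp: modulation_space_def)
  then have fin: "energy p (fock (hermite_coeff f)) < \<infinity>" by (simp add: modulation_integral_eq_energy)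
  define B where "B N = distribution_of (bochner_riesz \<alpha> N f)" for N
  have B: "tempered_distribution (B N)" for N
    unfolding B_def by (intro distribution_of_tempered bochner_riesz_schwartz f)
  have coeff: "hermite_coeff (B N) = coeff_mult (riesz_weight \<alpha> N) (hermite_coeff f)" for N
    by (simp add: fun_eq_iff hermite_coeff_def coeff_mult_def B_def bochner_riesz_moments[OF f])
  have ent: "entire_coeffs (hermite_coeff f)" by (rule hermite_coeff_entire[OF f])
  note ap = approximating_riesz_all[OF assms(1,3), unfolded approximating_def]
  obtain C :: real where C: "\<And>N. N \<ge> 1 \<Longrightarrow> energy p (fock (hermite_coeff (B N))) \<le> ennreal C * energy p (fock (hermite_coeff f))"
    using ap ent unfolding coeff by blast
  have "B N \<in> modulation_space p" if "N \<ge> 1" for N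
  proof -
    have "ennreal C * energy p (fock (hermite_coeff f)) < \<infinity>" using fin by (simp add: ennreal_mult_less_top)
    then have "modulation_integral p (B N) < \<infinity>"
      unfolding modulation_integral_eq_energy[OF B] using C[OF that] by (rule order_le_less_trans[rotated])
    then show ?thesis using B by (simp add: modulation_space_def)
  qed
  moreover have "(\<lambda>N. modulation_integral p (\<lambda>g. B N g - f g)) \<longlonglongrightarrow> 0"
    unfolding modulation_integral_diff_eq_energy[OF B f] coeff using ap ent fin by blast
  then have "(\<lambda>N. modulation_norm p (\<lambda>g. B N g - f g)) \<longlonglongrightarrow> 0"
    using assms(1) by (intro modulation_norm_tendsto_0) auto
  ultimately show ?thesis by (simp add: B_def)
qed

end
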